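(* Let $q$ be a prime power. Let $\mathcal{B}$ be either $\mathcal{B}(\mathbb{F}_q^n)$ (with $n\ge 2$) or $\mathcal{B}(\mathbb{F}_q^{n_1},\dots,\mathbb{F}_q^{n_r})$. Write $1/Z(\mathcal{B},u)=\prod_{i}(1-\lambda_i u)$ with all $\lambda_i\neq 0$. Then every eigenvalue $\lambda_i$ of $\mathcal{B}$ is of the form $\zeta q^{s}$ with $\zeta$ a root of unity and $s\in\mathbb{Q}$.
   Context: For a finite-dimensional vector space $V$ over a field $k$, the building $\mathcal{B}(V)$ is the simplicial complex whose vertices $x_W$ are the nonzero proper subspaces $W$ of $V$, a set of vertices being a simplex iff the corresponding subspaces form a flag (are totally ordered by inclusion). Two vertices $x_W,x_{W'}$ of $\mathcal{B}(V)$ are opposite iff $V=W\oplus W'$. For vector spaces $V_1,\dots,V_r$ over $k$, $\mathcal{B}(V_1,\dots,V_r)$ is the join $\mathcal{B}(V_1)*\cdots*\mathcal{B}(V_r)$: its vertex set is the disjoint union of the vertex sets, and its simplices are unions $S_1\cup\dots\cup S_r$ with $S_i$ a simplex of $\mathcal{B}(V_i)$; two vertices of the join are opposite iff they lie in the same $\mathcal{B}(V_i)$ and are opposite there. The link of a vertex $x$ is the subcomplex of simplices $A$ with $x\notin A$ and $A\cup\{x\}$ a simplex; links of vertices are again such joins (e.g. the link of $x_W$ in $\mathcal{B}(V)$ is identified with $\mathcal{B}(W)*\mathcal{B}(V/W)$ via $x_{W'}\mapsto x_{W'}$ if $W'\subsetneq W$ and $x_{W'}\mapsto x_{W'/W}$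 if $W'\supsetneq W$), with the induced opposition relation. A path of length $l$ is a sequence of vertices $(x_0,\dots,x_l)$ with $x_i\ne x_{i+1}$ and $\{x_i,x_{i+1}\}$ a simplex; it is geodesic if for each $1\le i\le l-1$, $x_{i-1}$ and $x_{i+1}$ are opposite in the link of $x_i$. A geodesic cycle of length $l$ is a sequence $(x_0,\dots,x_l)$ with $x_l=x_0$ such that $(x_0,x_1,\dots,x_l,x_1)$ is a geodesic path. For a finite such building, $N(l)$ is the number of geodesic cycles of length $l$ and the edge zeta function is $Z(\mathcal{B},u)=\exp\left(\sum_{l\ge1}\frac{N(l)}{l}u^l\right)$; $1/Z(\mathcal{B},u)$ is a polynomial with constant term $1$, and the eigenvalues of $\mathcal{B}$ are the nonzero $\lambda_i$ with $1/Z(\mathcal{B},u)=\prod_i(1-\lambda_iu)$. *)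

theory Defs
  imports
    Complex_Main
    "HOL-Library.Cardinality"
    "HOL-Library.Function_Algebras"
    "HOL-Library.Set_Algebras"
    "HOL-Number_Theory.Prime_Powers"
    "HOL-Computational_Algebra.Formal_Power_Series"
begin

section \<open>Vector spaces, quotients, direct sums\<close>

text \<open>
  The space of \<open>n\<close>-tuples over a field \<open>'k\<close> is the space of sequences vanishing from index \<open>n\<close> on,
  so that \<open>n\<close> is a term and all the factors of a join live in one type.
\<close>

definition fscale :: "'k::field \<Rightarrow> (nat \<Rightarrow> 'k) \<Rightarrow> (nat \<Rightarrow> 'k)" where
  "fscale c v = (\<lambda>i. c * v i)"

lemma vector_space_fscale: "vector_space fscale"
  by unfold_locales (auto simp: fscale_def fun_eq_iff algebra_simps)

definition coord_space :: "nat \<Rightarrow> (nat \<Rightarrow> 'k::field) set" where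
  "coord_space n = {v. \<forall>i\<ge>n. v i = 0}"

lemma subspace_coord_space: "module.subspace fscale (coord_space n)"
proof -
  interpret vector_space fscale by (rule vector_space_fscale)
  show ?thesis by (auto simp: subspace_def coord_space_def fscale_def)
qed

text \<open>
  The sum of two cosets in \<open>U / W\<close> is their elementwise (Minkowski) sum, so the operation \<open>+\<close> on
  sets from \<^theory>\<open>HOL-Library.Set_Algebras\<close> is the addition of the quotient space.
\<close>

definition quotient_space :: "'v::ab_group_add set \<Rightarrow> 'v set \<Rightarrow> 'v set set" where
  "quotient_space U W = (\<lambda>u. u +o W) ` U"

text \<open>
  \<open>V = A \<oplus> B\<close> for subspaces \<open>A\<close>, \<open>B\<close> of \<open>V\<close>. Only \<open>+\<close> is used, so the definition applies to
  vectors and, verbatim, to the cosets that make up a quotient space.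
\<close>

definition direct_sum :: "'v::plus set \<Rightarrow> 'v set \<Rightarrow> 'v set \<Rightarrow> bool" where
  "direct_sum V A B \<longleftrightarrow>
     A \<subseteq> V \<and> B \<subseteq> V \<and> (\<forall>v\<in>V. \<exists>!p. p \<in> A \<times> B \<and> v = fst p + snd p)"

section \<open>Simplicial complexes, links and joins\<close>

text \<open>
  A complex is its set of simplices, the empty simplex included; \<open>x\<close> is a vertex of \<open>K\<close> iff
  \<open>x \<in> \<Union>K\<close>.
\<close>

definition link :: "'x set set \<Rightarrow> 'x \<Rightarrow> 'x set set" where
  "link K x = {A. x \<notin> A \<and> insert x A \<in> K}"

text \<open>The join of a list of complexes; the vertex \<open>x\<close> of the \<open>i\<close>-th one becomes \<open>(i, x)\<close>.\<close>

definition join :: "'x set set list \<Rightarrow> (nat \<times> 'x) set set" where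
  "join Ks = {\<Union>i<length Ks. Pair i ` S i |S. \<forall>i<length Ks. S i \<in> Ks ! i}"

section \<open>The building of a vector space, and joins of such buildings\<close>

definition proper_subspaces ::
    "('k::field \<Rightarrow> 'v::ab_group_add \<Rightarrow> 'v) \<Rightarrow> 'v set \<Rightarrow> 'v set set" where
  "proper_subspaces scale V = {W. module.subspace scale W \<and> W \<subseteq> V \<and> W \<noteq> {0} \<and> W \<noteq> V}"

definition building ::
    "('k::field \<Rightarrow> 'v::ab_group_add \<Rightarrow> 'v) \<Rightarrow> 'v set \<Rightarrow> 'v set set set" where
  "building scale V = {S. S \<subseteq> proper_subspaces scale V \<and> finite S \<and> chain_subset S}"

definition join_building ::
    "('k::field \<Rightarrow> 'v::ab_group_add \<Rightarrow> 'v) \<Rightarrow> 'v set list \<Rightarrow> (nat \<times> 'v set) set set" where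
  "join_building scale Vs = join (map (building scale) Vs)"

text \<open>
  The identification of the vertices of the link of \<open>W\<close> in the building of \<open>V\<close> with the vertices
  of the join of the buildings of \<open>W\<close> (left summand) and \<open>V / W\<close> (right summand).
\<close>

definition link_vertex :: "'v::ab_group_add set \<Rightarrow> 'v set \<Rightarrow> 'v set + 'v set set" where
  "link_vertex W A = (if A \<subset> W then Inl A else Inr (quotient_space A W))"

text \<open>
  \<open>link_opp scale V W A B\<close>: \<open>A\<close> and \<open>B\<close> are opposite vertices of the link of \<open>W\<close> in the building
  of \<open>V\<close>. The relator \<^const>\<open>rel_sum\<close> expresses that opposite vertices of the join lie in the same
  summand and are opposite there.
\<close>

definition link_opp ::
    "('k::field \<Rightarrow> 'v::ab_group_add \<Rightarrow> 'v) \<Rightarrow> 'v set \<Rightarrow> 'v set \<Rightarrow> 'v set \<Rightarrow> 'v set \<Rightarrow> bool" where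
  "link_opp scale V W A B \<longleftrightarrow>
     {A} \<in> link (building scale V) W \<and> {B} \<in> link (building scale V) W \<and>
     rel_sum (direct_sum W) (direct_sum (quotient_space V W)) (link_vertex W A) (link_vertex W B)"

text \<open>
  The link of \<open>(i, W)\<close> in the join of the buildings of \<open>V\<^sub>1, \<dots>, V\<^sub>r\<close> is the join of the buildings of
  the \<open>V\<^sub>j\<close> with \<open>j \<noteq> i\<close> and of the link of \<open>W\<close> in the building of \<open>V\<^sub>i\<close>.
\<close>

definition join_link_opp ::
    "('k::field \<Rightarrow> 'v::ab_group_add \<Rightarrow> 'v) \<Rightarrow> 'v set list \<Rightarrow>
     nat \<times> 'v set \<Rightarrow> nat \<times> 'v set \<Rightarrow> nat \<times> 'v set \<Rightarrow> bool" where
  "join_link_opp scale Vs x y z \<longleftrightarrow>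
     {y} \<in> link (join_building scale Vs) x \<and> {z} \<in> link (join_building scale Vs) x \<and>
     fst y = fst z \<and>
     (if fst y = fst x then link_opp scale (Vs ! fst x) (snd x) (snd y) (snd z)
      else direct_sum (Vs ! fst y) (snd y) (snd z))"

section \<open>Geodesic cycles and the edge zeta function\<close>

text \<open>
  Here \<open>K\<close> is a complex and \<open>opp x y z\<close> means that \<open>y\<close> and \<open>z\<close> are opposite in the link of \<open>x\<close>.
  A path of length \<open>l\<close> is a list of length \<open>l + 1\<close>.
\<close>

definition is_path :: "'x set set \<Rightarrow> 'x list \<Rightarrow> bool" where
  "is_path K xs \<longleftrightarrow> xs \<noteq> [] \<and> set xs \<subseteq> \<Union>K \<and>
     (\<forall>i. Suc i < length xs \<longrightarrow> xs ! i \<noteq> xs ! Suc i \<and> {xs ! i, xs ! Suc i} \<in> K)"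

definition is_geodesic ::
    "'x set set \<Rightarrow> ('x \<Rightarrow> 'x \<Rightarrow> 'x \<Rightarrow> bool) \<Rightarrow> 'x list \<Rightarrow> bool" where
  "is_geodesic K opp xs \<longleftrightarrow> is_path K xs \<and>
     (\<forall>i. 1 \<le> i \<and> i + 1 < length xs \<longrightarrow> opp (xs ! i) (xs ! (i - 1)) (xs ! (i + 1)))"

definition geodesic_cycles ::
    "'x set set \<Rightarrow> ('x \<Rightarrow> 'x \<Rightarrow> 'x \<Rightarrow> bool) \<Rightarrow> nat \<Rightarrow> 'x list set" where
  "geodesic_cycles K opp l =
     {xs. length xs = l + 1 \<and> xs ! l = xs ! 0 \<and> is_geodesic K opp (xs @ [xs ! 1])}"

definition edge_zeta :: "'x set set \<Rightarrow> ('x \<Rightarrow> 'x \<Rightarrow> 'x \<Rightarrow> bool) \<Rightarrow> complex fps" where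
  "edge_zeta K opp =
     fps_exp 1 oo
       Abs_fps (\<lambda>l. if l = 0 then 0 else of_nat (card (geodesic_cycles K opp l)) / of_nat l)"

text \<open>\<open>es\<close> lists the eigenvalues with multiplicity.\<close>

definition eigenvalue_list ::
    "'x set set \<Rightarrow> ('x \<Rightarrow> 'x \<Rightarrow> 'x \<Rightarrow> bool) \<Rightarrow> complex list \<Rightarrow> bool" where
  "eigenvalue_list K opp es \<longleftrightarrow>
     0 \<notin> set es \<and> inverse (edge_zeta K opp) = (\<Prod>e\<leftarrow>es. 1 - fps_const e * fps_X)"

definition root_of_unity_times_power :: "nat \<Rightarrow> complex \<Rightarrow> bool" where
  "root_of_unity_times_power q e \<longleftrightarrow>
     (\<exists>(\<zeta>::complex) (m::nat) (s::rat). 0 < m \<and> \<zeta> ^ m = 1 \<and>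
        e = \<zeta> * complex_of_real (real q powr real_of_rat s))"

end

theory Submission
  imports "Jordan_Normal_Form.Schur_Decomposition"
    "HOL-Computational_Algebra.Polynomial_FPS" Defs
begin

text \<open>
  Eigenvalues of a building are nonzero eigenvalues of the operator \<open>T\<close> on its oriented edges that
  continues a geodesic by one edge, since \<open>N(l)\<close> is the trace of \<open>T\<^sup>l\<close>. On the flags \<open>A < W\<close>,
  \<open>T\<close> alternates between an operator \<open>s\<^sub>1\<close>, which replaces \<open>A\<close> by a complement in \<open>W\<close>, and an
  operator \<open>s\<^sub>2\<close>, which replaces \<open>W\<close> by a complement modulo \<open>A\<close>. They satisfy the braid relation
  \<open>s\<^sub>1 s\<^sub>2 s\<^sub>1 = s\<^sub>2 s\<^sub>1 s\<^sub>2\<close> (both sides run over the opposite flags), hence the full twist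
  \<open>(s\<^sub>1 s\<^sub>2)\<^sup>3\<close> commutes with \<open>s\<^sub>1\<close> and \<open>s\<^sub>2\<close>. On an eigenspace of the full twist, of dimension
  \<open>d\<close>, the determinant shows that the \<open>d\<close>-th power of the eigenvalue is a product of eigenvalues of
  \<open>s\<^sub>1\<close> and \<open>s\<^sub>2\<close>, and the numbers \<open>\<zeta> q\<^sup>s\<close> form a group closed under taking roots. Finally, an
  eigenvalue of the complement operator is, up to sign, a square root of a power of \<open>q\<close>: the sums of
  an eigenfunction over the subspaces of fixed dimension that contain \<open>X\<close> transform by Moebius
  inversion, and at a minimal \<open>X\<close> with nonzero sum only one term survives. On an edge between two
  factors of a join, \<open>T\<close> alternates between two commuting complement operators.
\<close>

section \<open>Counting complements\<close>

locale finite_field_space = vector_space scale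
  for scale :: "'k::{field,finite} \<Rightarrow> 'v::ab_group_add \<Rightarrow> 'v"  (infixr \<open>*s\<close> 75)
begin

definition subspaces_of :: "'v set \<Rightarrow> 'v set set" where
  "subspaces_of U = {A. subspace A \<and> A \<subseteq> U}"

text \<open>Containment of both spaces in \<open>U\<close> follows from \<open>A + B = U\<close>,
  see \<open>complements_subset\<close>; between subspaces the relation is symmetric.\<close>

definition complements :: "'v set \<Rightarrow> 'v set \<Rightarrow> 'v set set" where
  "complements U A = {B. subspace B \<and> A \<inter> B = {0} \<and> A + B = U}"

lemma card_field_ge_2: "CARD('k) \<ge> 2"
proof -
  have "card {0, 1 :: 'k} \<le> CARD('k)" by (intro card_mono) auto
  then show ?thesis by simp
qed

text \<open>The map \<open>(c, a) \<mapsto> c *s v + a\<close> is a bijection from pairs onto the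
  new span: a coincidence with different scalars would put \<open>v\<close> into
  \<open>A\<close>.\<close>

lemma card_span_insert:
  assumes "subspace A" "finite A" "v \<notin> A"
  shows "finite (span (insert v A))" "card (span (insert v A)) = CARD('k) * card A"
proof -
  have im: "span (insert v A) = (\<lambda>(c, a). c *s v + a) ` (UNIV \<times> A)"
  proof (intro equalityI subsetI)
    fix x assume "x \<in> span (insert v A)"
    then obtain k where "x - k *s v \<in> span A" using span_breakdown_eq by blast
    then have "x - k *s v \<in> A" using assms(1) span_eq_iff by blast
    then show "x \<in> (\<lambda>(c, a). c *s v + a) ` (UNIV \<times> A)"
      by (intro image_eqI[of _ _ "(k, x - k *s v)"]) auto
  next
    fix x assume "x \<in> (\<lambda>(c, a). c *s v + a) ` (UNIV \<times> A)"
    then show "x \<in> span (insert v A)"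
      by (auto intro!: span_add span_scale intro: span_base)
  qed
  have inj: "inj_on (\<lambda>(c, a). c *s v + a) (UNIV \<times> A)"
  proof (rule inj_onI, clarsimp)
    fix c a c' a' assume a: "a \<in> A" "a' \<in> A" and eq: "c *s v + a = c' *s v + a'"
    have d: "(c - c') *s v = a' - a" using eq by (simp add: scale_left_diff_distrib algebra_simps)
    have "c = c'"
    proof (rule ccontr)
      assume ne: "c \<noteq> c'"
      have "v = inverse (c - c') *s ((c - c') *s v)" using ne by simp
      also have "\<dots> \<in> A" unfolding d using assms(1) a by (simp add: subspace_scale subspace_diff)
      finally show False using assms(3) by simp
    qed
    then show "c = c' \<and> a = a'" using eq by simp
  qed
  show "finite (span (insert v A))" unfolding im using assms(2) by simp
  show "card (span (insert v A)) = CARD('k) * card A"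
    unfolding im by (simp add: card_image[OF inj] card_cartesian_product)
qed

lemma card_subspace:
  assumes "subspace A" "finite A"
  shows "card A = CARD('k) ^ dim A"
proof -
  obtain B where B: "B \<subseteq> A" "independent B" "A \<subseteq> span B" "card B = dim A"
    by (rule basis_exists)
  have "finite B" using B assms finite_subset by blast
  then have "independent B \<Longrightarrow> finite (span B) \<and> card (span B) = CARD('k) ^ card B"
  proof (induction B rule: finite_induct)
    case (insert v B)
    have "v \<notin> span B" and ind: "independent B"
      using insert by (auto simp: independent_insert split: if_splits)
    from insert.IH[OF ind] card_span_insert[OF subspace_span _ this(1)]
    have "finite (span (insert v (span B)))" "card (span (insert v (span B))) = CARD('k) * CARD('k) ^ card B"
      by auto
    moreover have "span (insert v (span B)) = span (insert v B)" by (simp only: span_insert span_span)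
    ultimately show ?case using insert by simp
  qed auto
  moreover have "span B = A" using B assms by (metis span_subspace)
  ultimately show ?thesis using B by auto
qed

lemma dim_eq_iff_card:
  assumes "subspace A" "finite A" "card A = CARD('k) ^ m"
  shows "dim A = m"
  using card_subspace[OF assms(1,2)] assms(3) card_field_ge_2 by (simp add: power_inject_exp)

lemma card_sum_subspaces:
  assumes "subspace A" "subspace B" "A \<inter> B = {0}"
  shows "card (A + B) = card A * card B"
proof -
  have im: "A + B = (\<lambda>(a, b). a + b) ` (A \<times> B)" by (auto simp: set_plus_def)
  have "inj_on (\<lambda>(a, b). a + b) (A \<times> B)"
  proof (rule inj_onI, clarsimp)
    fix a b a' b' assume *: "a \<in> A" "a' \<in> A" "b \<in> B" "b' \<in> B" and eq: "a + b = a' + b'"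
    have d: "a - a' = b' - b" using eq by (simp add: algebra_simps)
    then have "a - a' \<in> A \<inter> B" using * assms by (metis IntI subspace_diff)
    then have "a - a' = 0" using assms(3) by blast
    then show "a = a' \<and> b = b'" using d by simp
  qed
  then show ?thesis unfolding im by (simp add: card_image card_cartesian_product)
qed

lemma sum_subspaces_subset:
  assumes "subspace U" "A \<subseteq> U" "B \<subseteq> U"
  shows "A + B \<subseteq> U"
  using assms by (auto simp: set_plus_def intro!: subspace_add)

lemma subset_sum_left: "subspace B \<Longrightarrow> A \<subseteq> A + B"
  by (metis set_zero_plus2 subspace_0 add.commute)

lemma subset_sum_right: "subspace A \<Longrightarrow> B \<subseteq> A + B"
  by (metis set_zero_plus2 subspace_0)

lemma complements_commute: "subspace A \<Longrightarrow> B \<in> complements U A \<longleftrightarrow> subspace B \<and> A \<in> complements U B"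
  by (auto simp: complements_def Int_commute add.commute)

lemma complements_subset: "subspace A \<Longrightarrow> B \<in> complements U A \<Longrightarrow> A \<subseteq> U \<and> B \<subseteq> U"
  by (auto simp: complements_def dest: subset_sum_left subset_sum_right)

lemma dim_complement:
  assumes "finite U" "subspace U" "subspace A" "B \<in> complements U A"
  shows "dim A + dim B = dim U"
proof -
  have "A \<subseteq> U" "B \<subseteq> U" using complements_subset assms by auto
  then have fin: "finite A" "finite B" using assms(1) finite_subset by auto
  have "card U = card A * card B"
    using assms card_sum_subspaces[of A B] by (auto simp: complements_def)
  then have "CARD('k) ^ dim U = CARD('k) ^ (dim A + dim B)"
    using assms fin card_subspace[of A] card_subspace[of B] card_subspace[of U]
    by (simp add: power_add complements_def)
  then show ?thesis using card_field_ge_2 by (simp add: power_inject_exp)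
qed

text \<open>Induction on \<open>m\<close>, the codimension of \<open>X + B\<close> in
  \<open>U\<close>, which the cardinality hypothesis encodes. For \<open>m = 0\<close> the space
  \<open>X\<close> is the only complement above itself. Otherwise pick \<open>v\<close> in
  \<open>U\<close> outside \<open>X + B\<close>: a complement above \<open>X\<close> contains
  \<open>v + b\<close> for exactly one \<open>b \<in> B\<close>, so the complements split into
  \<open>card B\<close> classes, each counted by the induction hypothesis for the span of
  \<open>X\<close> and \<open>v + b\<close>.\<close>

lemma card_complements_above:
  assumes "subspace U" "finite U" "subspace B" "B \<subseteq> U"
    and "subspace X" "X \<subseteq> U" "X \<inter> B = {0}" "card U = card X * card B * CARD('k) ^ m"
  shows "card {A \<in> complements U B. X \<subseteq> A} = card B ^ m"
proof -
  note base = assms(1-4)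
  show ?thesis
  using assms(5-)
proof (induction m arbitrary: X)
  case 0
  have "card (X + B) = card U" using "0.prems" card_sum_subspaces[of X B] base(3) by simp
  then have XB: "X + B = U"
    using card_subset_eq[OF base(2)] sum_subspaces_subset[OF base(1)] 0 base by blast
  have "A = X" if A: "A \<in> complements U B" "X \<subseteq> A" for A
  proof -
    have "card A * card B = card U" "finite A"
      using A base card_sum_subspaces[of A B] complements_subset[of B A U] finite_subset
      by (auto simp: complements_def Int_commute add.commute)
    moreover have "card B \<noteq> 0" using base finite_subset subspace_0 by (metis card_0_eq empty_iff)
    ultimately have "card A = card X" using "0.prems" by simp
    then show ?thesis using A \<open>finite A\<close> by (metis card_subset_eq)
  qed
  moreover have "X \<in> complements U B" using XB 0 by (auto simp: complements_def Int_commute add.commute)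
  ultimately have "{A \<in> complements U B. X \<subseteq> A} = {X}" by auto
  then show ?case by simp
next
  case (Suc m)
  have cp: "card U > 0" using base(1,2) subspace_0 by (metis card_gt_0_iff empty_iff)
  have XBU: "X + B \<subseteq> U" using sum_subspaces_subset[OF base(1)] Suc base by blast
  have "card (X + B) < card U"
  proof -
    have "1 < CARD('k) * CARD('k) ^ m"
      using card_field_ge_2 one_less_power[of "CARD('k)" "Suc m"] by simp
    then show ?thesis using Suc.prems(4) card_sum_subspaces[of X B] Suc.prems base(3) cp by simp
  qed
  then obtain v where v: "v \<in> U" "v \<notin> X + B" using XBU by (metis less_irrefl subsetI subset_antisym)
  define X' where "X' b = span (insert (v + b) X)" for b
  have vbX: "v + b \<notin> X" if "b \<in> B" for b
  proof
    assume "v + b \<in> X"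
    then have "(v + b) + (- b) \<in> X + B" using that base by (intro set_plus_intro) (auto simp: subspace_neg)
    then show False using v by simp
  qed
  have "card {A \<in> complements U B. X' b \<subseteq> A} = card B ^ m" if b: "b \<in> B" for b
  proof (rule Suc.IH)
    show "subspace (X' b)" by (simp add: X'_def)
    show "X' b \<subseteq> U" unfolding X'_def using Suc.prems base b v
      by (intro span_minimal) (auto simp: subspace_add)
    show "X' b \<inter> B = {0}"
    proof (intro equalityI subsetI)
      fix y assume y: "y \<in> X' b \<inter> B"
      then obtain c where "y - c *s (v + b) \<in> span X" unfolding X'_def using span_breakdown_eq by blast
      then have x: "y - c *s (v + b) \<in> X" using Suc.prems span_eq_iff by blast
      show "y \<in> {0}"
      proof (cases "c = 0")
        case True
        then show ?thesis using x y Suc.prems by auto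
      next
        case False
        \<comment> \<open>For \<open>c \<noteq> 0\<close> the relation can be solved for
          \<open>v\<close>, which would put \<open>v\<close> in \<open>X + B\<close>.\<close>
        have e: "v = - (inverse c *s (y - c *s (v + b))) + (inverse c *s y - b)"
          using False by (simp add: scale_right_diff_distrib scale_right_distrib)
        have "v \<in> X + B"
          by (subst e, rule set_plus_intro)
            (use x y b base Suc.prems in \<open>auto intro!: subspace_neg subspace_scale subspace_diff\<close>)
        then show ?thesis using v by simp
      qed
    qed (use base in \<open>auto simp: X'_def subspace_0 span_zero\<close>)
    show "card U = card (X' b) * card B * CARD('k) ^ m"
      using card_span_insert[OF _ _ vbX[OF b]] Suc.prems finite_subset[OF _ base(2)]
      by (simp add: X'_def)
  qed
  moreover have "{A \<in> complements U B. X \<subseteq> A} = (\<Union>b\<in>B. {A \<in> complements U B. X' b \<subseteq> A})"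
  proof (intro equalityI subsetI)
    fix A assume A: "A \<in> {A \<in> complements U B. X \<subseteq> A}"
    then have "v \<in> B + A" using v by (auto simp: complements_def)
    then obtain b a where ab: "b \<in> B" "a \<in> A" "v = b + a" by (auto simp: set_plus_def)
    \<comment> \<open>Since \<open>v = b + a\<close> with \<open>a \<in> A\<close>, the space
      \<open>A\<close> belongs to the class of \<open>- b\<close>.\<close>
    then have "v + (- b) \<in> A" "- b \<in> B" using base by (auto simp: subspace_neg)
    then have "X' (- b) \<subseteq> A" unfolding X'_def using A by (intro span_minimal) (auto simp: complements_def)
    then show "A \<in> (\<Union>b\<in>B. {A \<in> complements U B. X' b \<subseteq> A})" using A \<open>- b \<in> B\<close> by blast
  next
    fix A assume "A \<in> (\<Union>b\<in>B. {A \<in> complements U B. X' b \<subseteq> A})"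
    moreover have "X \<subseteq> X' b" for b unfolding X'_def by (meson span_superset subset_insertI subset_trans)
    ultimately show "A \<in> {A \<in> complements U B. X \<subseteq> A}" by blast
  qed
  moreover have "{A \<in> complements U B. X' b \<subseteq> A} \<inter> {A \<in> complements U B. X' b' \<subseteq> A} = {}"
    if "b \<in> B" "b' \<in> B" "b \<noteq> b'" for b b'
  proof (rule ccontr)
    assume "\<not> ?thesis"
    then obtain A where A: "A \<in> complements U B" "X' b \<subseteq> A" "X' b' \<subseteq> A" by blast
    have "v + b \<in> A" "v + b' \<in> A" using A unfolding X'_def by (meson insertI1 span_base subsetD)+
    then have "(v + b) - (v + b') \<in> A" using A by (intro subspace_diff) (auto simp: complements_def)
    then have "b - b' \<in> B \<inter> A" using that base by (auto simp: subspace_diff)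
    then have "b - b' = 0" using A unfolding complements_def by blast
    then show False using that by simp
  qed
  moreover have "finite (complements U B)"
    using base(2) complements_subset[OF base(3)] finite_subset[of "complements U B" "Pow U"] by blast
  ultimately show ?case using finite_subset[OF base(4,2)]
    by (simp add: card_UN_disjoint)
qed
qed

section \<open>The Moebius function of the lattice of subspaces\<close>

text \<open>This is the Moebius function of the subspace lattice over the field with
  \<open>CARD('k)\<close> elements, between the zero space and a space of dimension
  \<open>j\<close>.\<close>

definition moebius :: "nat \<Rightarrow> complex" where
  "moebius j = (-1) ^ j * of_nat CARD('k) ^ (j choose 2)"

lemma moebius_Suc: "moebius (Suc j) = - (of_nat CARD('k) ^ j * moebius j)"
proof -
  have "Suc j choose 2 = j + (j choose 2)" by (simp add: numeral_2_eq_2)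
  then show ?thesis by (simp add: moebius_def power_add)
qed

lemma finite_subspaces_of: "finite U \<Longrightarrow> finite (subspaces_of U)"
  by (rule finite_subset[of _ "Pow U"]) (auto simp: subspaces_of_def)

text \<open>Fix a line \<open>a\<close> spanned by some \<open>v \<in> Z\<close> and send each
  \<open>Y\<close> that misses \<open>v\<close> to \<open>Y + a\<close>. The fibre over
  \<open>Y'\<close> of dimension \<open>m + 1\<close> consists of the complements of
  \<open>a\<close> in \<open>Y'\<close>. There are \<open>CARD('k) ^ m\<close> of them, all of
  dimension \<open>m\<close>, so by \<open>moebius_Suc\<close> their contribution cancels that of
  \<open>Y'\<close>.\<close>

lemma sum_moebius_eq_0:
  assumes "subspace Z" "finite Z" "Z \<noteq> {0}"
  shows "(\<Sum>Y\<in>subspaces_of Z. moebius (dim Y)) = 0"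
proof -
  obtain v where v: "v \<in> Z" "v \<noteq> 0" using assms subspace_0 by blast
  define a where "a = span {v}"
  have a: "subspace a" "finite a" "card a = CARD('k)" "v \<in> a" "a \<subseteq> Z"
    using card_span_insert[of "{0}" v] v assms span_minimal[of "{v}" Z]
    by (auto simp: a_def span_base insert_commute )
  define L where "L = {Y \<in> subspaces_of Z. v \<in> Y}"
  define N where "N = {Y \<in> subspaces_of Z. v \<notin> Y}"
  have fin: "finite L" "finite N" using finite_subspaces_of[OF assms(2)] by (auto simp: L_def N_def)
  have sumN: "(\<Sum>Y | Y \<in> N \<and> Y + a = Y'. moebius (dim Y)) = - moebius (dim Y')" if Y': "Y' \<in> L" for Y'
  proof -
    have Y'': "subspace Y'" "finite Y'" "v \<in> Y'" "Y' \<subseteq> Z"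
      using Y' finite_subset[OF _ assms(2)] by (auto simp: L_def subspaces_of_def)
    have aY': "a \<subseteq> Y'" unfolding a_def using Y'' by (intro span_minimal) auto
    have "dim Y' \<noteq> 0"
    proof
      assume "dim Y' = 0"
      then have "card Y' = 1" using card_subspace[of Y'] Y'' by simp
      then show False using Y'' v subspace_0[of Y'] by (metis card_1_singletonE singletonD)
    qed
    then obtain m where m: "dim Y' = Suc m" using not0_implies_Suc by blast
    have eq: "{Y. Y \<in> N \<and> Y + a = Y'} = complements Y' a"
    proof (intro equalityI subsetI)
      fix Y assume Y: "Y \<in> {Y. Y \<in> N \<and> Y + a = Y'}"
      then have sY: "subspace Y" "v \<notin> Y" by (auto simp: N_def subspaces_of_def)
      have "x = 0" if x: "x \<in> a" "x \<in> Y" for x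
      proof -
        obtain c where c: "x = c *s v" using x unfolding a_def span_singleton by auto
        show "x = 0"
        proof (rule ccontr)
          assume "x \<noteq> 0"
          then have "v = inverse c *s x" using c by auto
          then show False using sY x subspace_scale by metis
        qed
      qed
      then show "Y \<in> complements Y' a" using Y sY a subspace_0
        by (auto simp: complements_def add.commute)
    next
      fix Y assume Y: "Y \<in> complements Y' a"
      then have "Y \<subseteq> Y'" using complements_subset a by blast
      moreover have "v \<notin> Y" using Y a v by (auto simp: complements_def)
      ultimately show "Y \<in> {Y. Y \<in> N \<and> Y + a = Y'}" using Y Y''
        by (auto simp: N_def subspaces_of_def complements_def add.commute)
    qed
    \<comment> \<open>The count of complements above \<open>{0}\<close>, with \<open>m\<close> the
      codimension of \<open>a\<close> in \<open>Y'\<close>.\<close>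
    have "card {A \<in> complements Y' a. {0} \<subseteq> A} = card a ^ m"
      using a aY' Y'' card_subspace[of Y'] m
      by (intro card_complements_above) (auto simp: subspace_0)
    moreover have "{A \<in> complements Y' a. {0} \<subseteq> A} = complements Y' a"
      by (auto simp: complements_def subspace_0)
    ultimately have card: "card (complements Y' a) = CARD('k) ^ m" using a by simp
    have dim: "dim Y = m" if "Y \<in> complements Y' a" for Y
    proof -
      have "dim a = 1" using dim_eq_iff_card[of a 1] a by simp
      then show ?thesis using dim_complement[OF Y''(2,1) a(1) that] m by simp
    qed
    show ?thesis unfolding eq using dim by (simp add: card m moebius_Suc)
  qed
  have img: "(\<lambda>Y. Y + a) ` N \<subseteq> L"
  proof (rule image_subsetI)
    fix Y assume "Y \<in> N"
    then have Y: "subspace Y" "Y \<subseteq> Z" by (auto simp: N_def subspaces_of_def)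
    moreover have "Y + a = {x + y |x y. x \<in> Y \<and> y \<in> a}" by (auto simp: set_plus_def)
    ultimately show "Y + a \<in> L" using subspace_sums[OF Y(1) a(1)] sum_subspaces_subset[OF assms(1) Y(2) a(5)]
      subset_sum_right[of Y a] a by (auto simp: L_def subspaces_of_def)
  qed
  have "(\<Sum>Y\<in>N. moebius (dim Y)) = (\<Sum>Y'\<in>L. \<Sum>Y | Y \<in> N \<and> Y + a = Y'. moebius (dim Y))"
    by (rule sum.group[OF fin(2,1) img, symmetric])
  also have "\<dots> = - (\<Sum>Y\<in>L. moebius (dim Y))" by (simp add: sumN sum_negf)
  finally have "(\<Sum>Y\<in>L. moebius (dim Y)) + (\<Sum>Y\<in>N. moebius (dim Y)) = 0" by simp
  moreover have "subspaces_of Z = L \<union> N" "L \<inter> N = {}" by (auto simp: L_def N_def)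
  ultimately show ?thesis using fin by (simp add: sum.union_disjoint)
qed

text \<open>Turns the condition \<open>X \<inter> B = {0}\<close> into a sum over the common
  subspaces of \<open>X\<close> and \<open>B\<close>, which can be interchanged with other
  sums.\<close>

lemma sum_moebius:
  assumes "subspace Z" "finite Z"
  shows "(\<Sum>Y\<in>subspaces_of Z. moebius (dim Y)) = (if Z = {0} then 1 else 0)"
proof (cases "Z = {0}")
  case True
  have "subspaces_of {0} = {{0}}" by (auto simp: subspaces_of_def subset_singleton_iff dest: subspace_0)
  moreover have "dim {0} = 0" by (rule dim_eq_iff_card) auto
  ultimately show ?thesis using True by (simp add: moebius_def binomial_eq_0)
qed (use sum_moebius_eq_0 assms in auto)

end

section \<open>Products of a root of unity and a rational power of \<open>q\<close>\<close>

lemma root_of_unity_times_power_of_nat_power: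
  assumes "q > 0"
  shows "root_of_unity_times_power q (of_nat q ^ m)"
  unfolding root_of_unity_times_power_def
  by (rule exI[of _ 1], rule exI[of _ 1], rule exI[of _ "of_nat m"])
    (use assms in \<open>simp add: powr_realpow\<close>)

lemma root_of_unity_times_power_mult:
  assumes "q > 0" "root_of_unity_times_power q a" "root_of_unity_times_power q b"
  shows "root_of_unity_times_power q (a * b)"
proof -
  obtain z m s where a: "0 < m" "z ^ m = 1" "a = z * complex_of_real (real q powr real_of_rat s)"
    using assms(2) unfolding root_of_unity_times_power_def by blast
  obtain z' m' s' where b: "0 < m'" "z' ^ m' = 1" "b = z' * complex_of_real (real q powr real_of_rat s')"
    using assms(3) unfolding root_of_unity_times_power_def by blast
  have "(z * z') ^ (m * m') = (z ^ m) ^ m' * (z' ^ m') ^ m"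
    by (simp add: power_mult_distrib power_mult[symmetric] mult.commute)
  then have "(z * z') ^ (m * m') = 1" using a b by simp
  moreover have "a * b = z * z' * complex_of_real (real q powr real_of_rat (s + s'))"
    using assms(1) a b by (simp add: powr_add of_rat_add)
  ultimately show ?thesis unfolding root_of_unity_times_power_def using a b
    by (metis nat_0_less_mult_iff)
qed

lemma root_of_unity_times_power_power:
  assumes "q > 0" "root_of_unity_times_power q a"
  shows "root_of_unity_times_power q (a ^ m)"
  using root_of_unity_times_power_of_nat_power[OF assms(1), of 0]
  by (induction m) (auto intro: root_of_unity_times_power_mult assms)

lemma root_of_unity_times_power_prod_list:
  assumes "q > 0" "\<And>a. a \<in> set as \<Longrightarrow> root_of_unity_times_power q a"
  shows "root_of_unity_times_power q (prod_list as)"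
  using assms(2) root_of_unity_times_power_of_nat_power[OF assms(1), of 0]
  by (induction as) (auto intro: root_of_unity_times_power_mult assms(1))

text \<open>A rational exponent can be divided by \<open>d\<close>: dividing \<open>a\<close> by
  \<open>q\<close> to the power \<open>s / d\<close> leaves a number whose \<open>d\<close>-th power
  is a root of unity.\<close>

lemma root_of_unity_times_power_root:
  assumes "q > 0" "d > 0" "root_of_unity_times_power q (a ^ d)"
  shows "root_of_unity_times_power q a"
proof -
  obtain z m s where z: "0 < m" "z ^ m = 1" "a ^ d = z * complex_of_real (real q powr real_of_rat s)"
    using assms(3) unfolding root_of_unity_times_power_def by blast
  define r where "r = complex_of_real (real q powr real_of_rat (s / of_nat d))"
  have r0: "r \<noteq> 0" using assms(1) by (simp add: r_def)
  have "(real q powr real_of_rat (s / of_nat d)) ^ d = real q powr real_of_rat s"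
    using assms by (simp add: powr_power of_rat_divide)
  then have rd: "r ^ d = complex_of_real (real q powr real_of_rat s)"
    by (metis r_def of_real_power)
  then have "(a / r) ^ d = z" using r0 z by (simp add: power_divide field_simps flip: rd)
  then have "(a / r) ^ (d * m) = 1" using z by (simp add: power_mult)
  moreover have "a = a / r * r" using r0 by simp
  ultimately show ?thesis unfolding root_of_unity_times_power_def r_def using z assms(2)
    by (metis nat_0_less_mult_iff)
qed

section \<open>The complement operator\<close>

context finite_field_space
begin

text \<open>The complement operator exchanges the dimensions \<open>k\<close> and
  \<open>dim U - k\<close>, hence the separation by dimension. Expressed through these sums, the
  operator becomes triangular with respect to inclusion of \<open>X\<close>.\<close>

definition grade_sum :: "'v set \<Rightarrow> ('v set \<Rightarrow> complex) \<Rightarrow> nat \<Rightarrow> 'v set \<Rightarrow> complex" where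
  "grade_sum U f k X = (\<Sum>A | A \<in> subspaces_of U \<and> X \<subseteq> A \<and> dim A = k. f A)"

lemma complements_subset_subspaces: "subspace A \<Longrightarrow> complements U A \<subseteq> subspaces_of U"
  using complements_subset by (auto simp: subspaces_of_def complements_def)

text \<open>If \<open>X\<close> meets \<open>B\<close> trivially, \<open>X + B\<close> is a direct
  sum inside \<open>U\<close>, so the truncated subtractions in the exponent are exact. A larger
  intersection leaves no complement of \<open>B\<close> above \<open>X\<close>.\<close>

lemma card_complements_above':
  assumes U: "subspace U" "finite U" and B: "B \<in> subspaces_of U" and X: "X \<in> subspaces_of U"
  shows "card {A \<in> complements U B. X \<subseteq> A} =
    (if X \<inter> B = {0} then CARD('k) ^ (dim B * (dim U - dim B - dim X)) else 0)"
proof (cases "X \<inter> B = {0}")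
  case True
  have sub: "subspace B" "B \<subseteq> U" "subspace X" "X \<subseteq> U"
    using B X by (auto simp: subspaces_of_def)
  then have fin: "finite B" "finite X" using U finite_subset by auto
  have "card X * card B \<le> card U"
    using card_sum_subspaces[of X B] sum_subspaces_subset[of U X B] card_mono[OF U(2), of "X + B"]
      True sub U by simp
  then have "CARD('k) ^ (dim X + dim B) \<le> CARD('k) ^ dim U"
    using sub fin U by (simp add: card_subspace power_add)
  then have le: "dim X + dim B \<le> dim U"
    using card_field_ge_2 by simp
  have "card U = card X * card B * CARD('k) ^ (dim U - dim B - dim X)"
    using sub fin U le by (simp add: card_subspace flip: power_add)
  from card_complements_above[OF U sub(1,2,3,4) True this] show ?thesis
    using True sub fin by (simp add: card_subspace power_mult)
next
  case False
  have "{A \<in> complements U B. X \<subseteq> A} = {}"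
  proof -
    have "X \<inter> B = {0}" if "A \<in> complements U B" "X \<subseteq> A" for A
      using that B X subspace_0 by (auto simp: complements_def subspaces_of_def)
    then show ?thesis using False by blast
  qed
  then show ?thesis using False by (simp only: card.empty if_False)
qed

text \<open>Sum the eigenvalue equation over all \<open>A\<close> of dimension \<open>k\<close>
  above \<open>X\<close> and interchange the sums. Each \<open>B\<close> of dimension
  \<open>dim U - k\<close> is then weighted by its number of complements above \<open>X\<close>, a
  fixed power of \<open>CARD('k)\<close> if \<open>X \<inter> B = {0}\<close> and 0 otherwise.
  Writing this indicator with \<open>sum_moebius\<close> and interchanging again produces grade sums
  at the subspaces of \<open>X\<close>.\<close>

lemma eigenfunction_grade_sum:
  assumes U: "subspace U" "finite U" and X: "X \<in> subspaces_of U" and k: "k \<le> dim U"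
    and ev: "\<And>A. A \<in> subspaces_of U \<Longrightarrow> \<mu> * f A = (\<Sum>B\<in>complements U A. f B)"
  shows "\<mu> * grade_sum U f k X = of_nat CARD('k) ^ ((dim U - k) * (k - dim X)) *
    (\<Sum>Y\<in>subspaces_of X. moebius (dim Y) * grade_sum U f (dim U - k) Y)"
proof -
  define SA where "SA = {A. A \<in> subspaces_of U \<and> X \<subseteq> A \<and> dim A = k}"
  define SB where "SB = {B. B \<in> subspaces_of U \<and> dim B = dim U - k}"
  define c where "c = (of_nat CARD('k) :: complex) ^ ((dim U - k) * (k - dim X))"
  have fin: "finite SA" "finite SB" "finite (subspaces_of X)" "finite (subspaces_of U)"
    using finite_subspaces_of[OF U(2)] finite_subspaces_of[of X] X finite_subset[OF _ U(2)]
    by (auto simp: SA_def SB_def subspaces_of_def)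
  \<comment> \<open>Being complementary is symmetric and complements of \<open>A\<close> have
    dimension \<open>dim U - k\<close>, so the double sum runs over a relation between
    \<open>SA\<close> and \<open>SB\<close>.\<close>
  have comp: "complements U A = {B \<in> SB. A \<in> complements U B}" if "A \<in> SA" for A
  proof (rule Set.set_eqI)
    fix B
    have A: "subspace A" "dim A = k" using that by (auto simp: SA_def subspaces_of_def)
    have "B \<in> SB" if "B \<in> complements U A"
      using that dim_complement[OF U(2,1) A(1) that] complements_subset_subspaces[OF A(1)] A(2)
      by (auto simp: SB_def)
    moreover have "B \<in> complements U A \<longleftrightarrow> A \<in> complements U B" if "subspace B"
      using complements_commute[OF A(1)] that by blast
    ultimately show "B \<in> complements U A \<longleftrightarrow> B \<in> {B \<in> SB. A \<in> complements U B}"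
      by (auto simp: SB_def subspaces_of_def)
  qed
  have "\<mu> * grade_sum U f k X = (\<Sum>A\<in>SA. \<Sum>B\<in>complements U A. f B)"
    unfolding grade_sum_def SA_def by (simp add: sum_distrib_left ev)
  also have "\<dots> = (\<Sum>A\<in>SA. \<Sum>B | B \<in> SB \<and> A \<in> complements U B. f B)"
    using comp by (intro sum.cong) auto
  also have "\<dots> = (\<Sum>B\<in>SB. \<Sum>A | A \<in> SA \<and> A \<in> complements U B. f B)"
    by (rule sum.swap_restrict[OF fin(1,2)])
  also have "\<dots> = (\<Sum>B\<in>SB. c * (\<Sum>Y | Y \<in> subspaces_of X \<and> Y \<subseteq> B. moebius (dim Y) * f B))"
  proof (rule sum.cong[OF refl])
    fix B assume B: "B \<in> SB"
    then have B': "subspace B" "B \<subseteq> U" "dim B = dim U - k" by (auto simp: SB_def subspaces_of_def)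
    have X': "subspace X" "X \<subseteq> U" using X by (auto simp: subspaces_of_def)
    have "{A. A \<in> SA \<and> A \<in> complements U B} = {A \<in> complements U B. X \<subseteq> A}"
    proof -
      have "dim A = k" if "A \<in> complements U B" for A
        using dim_complement[OF U(2,1) B'(1) that] B'(3) k by linarith
      then show ?thesis using complements_subset_subspaces[OF B'(1)] by (auto simp: SA_def)
    qed
    then have "(\<Sum>A | A \<in> SA \<and> A \<in> complements U B. f B) =
        of_nat (card {A \<in> complements U B. X \<subseteq> A}) * f B" by simp
    also have "of_nat (card {A \<in> complements U B. X \<subseteq> A}) = c * (if X \<inter> B = {0} then 1 else 0)"
      using card_complements_above'[OF U, of B X] B X k
      by (simp add: c_def SB_def)
    also have "(if X \<inter> B = {0} then 1 else 0 :: complex) =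
        (\<Sum>Y\<in>subspaces_of (X \<inter> B). moebius (dim Y))"
      using sum_moebius[of "X \<inter> B"] X' B' U finite_subset subspace_inter[of X B]
      by (metis inf.coboundedI1)
    also have "subspaces_of (X \<inter> B) = {Y. Y \<in> subspaces_of X \<and> Y \<subseteq> B}"
      by (auto simp: subspaces_of_def)
    finally show "(\<Sum>A | A \<in> SA \<and> A \<in> complements U B. f B) =
      c * (\<Sum>Y | Y \<in> subspaces_of X \<and> Y \<subseteq> B. moebius (dim Y) * f B)"
      by (simp add: sum_distrib_right mult.assoc)
  qed
  also have "\<dots> = c * (\<Sum>B\<in>SB. \<Sum>Y | Y \<in> subspaces_of X \<and> Y \<subseteq> B. moebius (dim Y) * f B)"
    by (simp add: sum_distrib_left)
  also have "\<dots> = c * (\<Sum>Y\<in>subspaces_of X. \<Sum>B | B \<in> SB \<and> Y \<subseteq> B. moebius (dim Y) * f B)"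
    by (simp add: sum.swap_restrict[OF fin(2,3)])
  also have "\<dots> = c * (\<Sum>Y\<in>subspaces_of X. moebius (dim Y) * grade_sum U f (dim U - k) Y)"
    by (simp add: grade_sum_def sum_distrib_left SB_def conj_ac)
  finally show ?thesis by (simp add: c_def)
qed

text \<open>Choose \<open>X\<close> of least cardinality with nonzero grade sum \<open>?F X\<close>.
  In the transformation formulas for \<open>?F\<close> and for the grade sum \<open>?G\<close> of
  complementary dimension, only the term at \<open>X\<close> survives, so
  \<open>\<mu> * ?F X\<close> and \<open>\<mu> * ?G X\<close> are multiples of \<open>?G X\<close>
  and \<open>?F X\<close>. Eliminating \<open>?G X\<close> makes \<open>\<mu>\<^sup>2\<close> a
  power of \<open>CARD('k)\<close>; the sign of the Moebius value disappears in the square.\<close>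

lemma complement_operator_eigenvalue:
  assumes U: "subspace U" "finite U" and "\<mu> \<noteq> 0" and A0: "A0 \<in> subspaces_of U" "f A0 \<noteq> 0"
    and ev: "\<And>A. A \<in> subspaces_of U \<Longrightarrow> \<mu> * f A = (\<Sum>B\<in>complements U A. f B)"
  shows "root_of_unity_times_power CARD('k) \<mu>"
proof -
  define k where "k = dim A0"
  have finA: "finite A" if "A \<in> subspaces_of U" for A
    using that finite_subset[OF _ U(2)] by (auto simp: subspaces_of_def)
  have "CARD('k) ^ k \<le> CARD('k) ^ dim U"
    using card_mono[OF U(2), of A0] finA[OF A0(1)] A0 U unfolding k_def
    by (auto simp: subspaces_of_def card_subspace)
  then have k: "k \<le> dim U" using card_field_ge_2 by simp
  \<comment> \<open>The grade sum at \<open>A0\<close> therefore reduces to \<open>f A0\<close>, so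
    some grade sum is nonzero and a minimal \<open>X\<close> exists.\<close>
  have "{A. A \<in> subspaces_of U \<and> A0 \<subseteq> A \<and> dim A = k} = {A0}"
  proof -
    have "A = A0" if A: "A \<in> subspaces_of U" "A0 \<subseteq> A" "dim A = k" for A
    proof -
      have "card A = card A0" using A A0 finA[of A] finA[of A0]
        by (simp add: card_subspace subspaces_of_def k_def)
      then show ?thesis using A finA[of A] by (metis card_subset_eq)
    qed
    then show ?thesis using A0 by (auto simp: k_def)
  qed
  then have "grade_sum U f k A0 \<noteq> 0" using A0 by (simp add: grade_sum_def)
  then obtain X where X: "X \<in> subspaces_of U" "grade_sum U f k X \<noteq> 0"
    and min: "\<And>Y. Y \<in> subspaces_of U \<Longrightarrow> card Y < card X \<Longrightarrow> grade_sum U f k Y = 0"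
    using ex_has_least_nat[of "\<lambda>X. X \<in> subspaces_of U \<and> grade_sum U f k X \<noteq> 0" A0 card] A0
    by (metis leD)
  let ?k' = "dim U - k"
  define c where "c = (of_nat CARD('k) :: complex) ^ (?k' * (k - dim X))"
  define c' where "c' = (of_nat CARD('k) :: complex) ^ (k * (?k' - dim X))"
  let ?F = "grade_sum U f k" and ?G = "grade_sum U f ?k'"
  have below: "Y \<in> subspaces_of U" "Y \<noteq> X \<Longrightarrow> ?F Y = 0"
    if Y: "Y \<in> subspaces_of X" for Y
  proof -
    show *: "Y \<in> subspaces_of U" using Y X by (auto simp: subspaces_of_def)
    show "?F Y = 0" if "Y \<noteq> X"
      using min[OF *] Y that finA[OF X(1)] by (auto simp: subspaces_of_def intro: psubset_card_mono)
  qed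
  have below_trans: "Z \<in> subspaces_of X" if "Z \<in> subspaces_of Y" "Y \<in> subspaces_of X" for Y Z
    using that by (auto simp: subspaces_of_def)
  have XX: "X \<in> subspaces_of X" using X by (auto simp: subspaces_of_def)
  have finX: "finite (subspaces_of X)" using finA[OF X(1)] finite_subspaces_of by blast
  \<comment> \<open>\<open>?F\<close> vanishes on everything strictly inside \<open>X\<close>; as
    \<open>\<mu> \<noteq> 0\<close>, the formula for \<open>?G\<close> makes it vanish there
    too.\<close>
  have G0: "?G Y = 0" if Y: "Y \<in> subspaces_of X" "Y \<noteq> X" for Y
  proof -
    have "moebius (dim Z) * ?F Z = 0" if Z: "Z \<in> subspaces_of Y" for Z
    proof -
      have "Z \<noteq> X" using Y Z by (auto simp: subspaces_of_def)
      then show ?thesis using below(2) below_trans[OF Z Y(1)] by simp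
    qed
    then have "(\<Sum>Z\<in>subspaces_of Y. moebius (dim Z) * ?F Z) = 0" by (intro sum.neutral ballI)
    then have "\<mu> * ?G Y = 0"
      using eigenfunction_grade_sum[OF U below(1)[OF Y(1)], of ?k' \<mu> f] ev k by simp
    then show ?thesis using assms(3) by simp
  qed
  have "(\<Sum>Y\<in>subspaces_of X. moebius (dim Y) * ?G Y) = (\<Sum>Y\<in>{X}. moebius (dim Y) * ?G Y)"
    using G0 XX finX by (intro sum.mono_neutral_right) auto
  then have FG: "\<mu> * ?F X = c * (moebius (dim X) * ?G X)"
    using eigenfunction_grade_sum[OF U X(1) k, of \<mu> f] ev by (simp add: c_def)
  have "(\<Sum>Y\<in>subspaces_of X. moebius (dim Y) * ?F Y) = (\<Sum>Y\<in>{X}. moebius (dim Y) * ?F Y)"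
    using below(2) XX finX by (intro sum.mono_neutral_right) auto
  then have GF: "\<mu> * ?G X = c' * (moebius (dim X) * ?F X)"
    using eigenfunction_grade_sum[OF U X(1), of ?k' \<mu> f] ev k by (simp add: c'_def)
  have "\<mu>\<^sup>2 * ?F X = c * moebius (dim X) * (\<mu> * ?G X)"
    using FG by (simp add: power2_eq_square)
  also have "\<dots> = (c * c' * (moebius (dim X))\<^sup>2) * ?F X"
    unfolding GF by (simp add: power2_eq_square)
  finally have "\<mu>\<^sup>2 = c * c' * (moebius (dim X))\<^sup>2" using X by simp
  also have "(moebius (dim X))\<^sup>2 = of_nat CARD('k) ^ (2 * (dim X choose 2))"
    by (simp add: moebius_def power_mult_distrib power_mult[symmetric] mult.commute)
  finally have "\<mu>\<^sup>2 = of_nat CARD('k) ^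
      (?k' * (k - dim X) + k * (?k' - dim X) + 2 * (dim X choose 2))"
    by (simp add: c_def c'_def power_add)
  then have "root_of_unity_times_power CARD('k) (\<mu>\<^sup>2)"
    using root_of_unity_times_power_of_nat_power by simp
  then show ?thesis by (rule root_of_unity_times_power_root[rotated 2]) auto
qed

end

section \<open>Traces of powers of a complex matrix\<close>

text \<open>The entries below the diagonal are included so that the induction closes: in the matrix
  product only the summand \<open>l = i\<close> survives.\<close>

lemma upper_triangular_pow:
  fixes B :: "'a::comm_ring_1 mat"
  assumes B: "B \<in> carrier_mat n n" and ut: "\<And>i j. i < n \<Longrightarrow> j < i \<Longrightarrow> B $$ (i, j) = 0"
    and ij: "i < n" "j \<le> i"
  shows "(B ^\<^sub>m k) $$ (i, j) = (if i = j then (B $$ (i, i)) ^ k else 0)"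
  using ij
proof (induction k arbitrary: i j)
  case 0
  then show ?case using B by auto
next
  case (Suc k)
  have "(B ^\<^sub>m Suc k) $$ (i, j) = (\<Sum>l<n. (B ^\<^sub>m k) $$ (i, l) * B $$ (l, j))"
    using B Suc.prems by (simp add: scalar_prod_def atLeast0LessThan)
  also have "\<dots> = (\<Sum>l<n. if l = i then (if i = j then (B $$ (i, i)) ^ Suc k else 0) else 0)"
  proof (rule sum.cong[OF refl])
    fix l assume l: "l \<in> {..<n}"
    consider "l < i" | "l = i" | "l > i" by linarith
    then show "(B ^\<^sub>m k) $$ (i, l) * B $$ (l, j) =
      (if l = i then (if i = j then (B $$ (i, i)) ^ Suc k else 0) else 0)"
      using Suc.IH[of i l] Suc.prems ut[of l j] l by cases (auto simp: mult.commute)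
  qed
  also have "\<dots> = (if i = j then (B $$ (i, i)) ^ Suc k else 0)" using Suc.prems by simp
  finally show ?case .
qed

lemma pow_mat_Suc_left:
  fixes A :: "'a::semiring_1 mat"
  assumes A: "A \<in> carrier_mat n n"
  shows "A ^\<^sub>m Suc k = A * A ^\<^sub>m k"
proof (induction k)
  case (Suc k)
  have "A ^\<^sub>m Suc (Suc k) = A * A ^\<^sub>m k * A" using Suc by simp
  also have "\<dots> = A * (A ^\<^sub>m k * A)" using A by (intro assoc_mult_mat) auto
  finally show ?case by simp
qed (use A in auto)

text \<open>Cyclicity of the trace moves \<open>Q\<close> to the front, where it cancels
  \<open>P\<close>.\<close>

lemma trace_similar:
  fixes P :: "'a::comm_ring_1 mat"
  assumes "P \<in> carrier_mat n n" "M \<in> carrier_mat n n" "Q \<in> carrier_mat n n" "Q * P = 1\<^sub>m n"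
  shows "(\<Sum>i<n. (P * M * Q) $$ (i, i)) = (\<Sum>i<n. M $$ (i, i))"
proof -
  have comm: "(\<Sum>i<n. (X * Y) $$ (i, i)) = (\<Sum>i<n. (Y * X) $$ (i, i))"
    if X: "X \<in> carrier_mat n n" and Y: "Y \<in> carrier_mat n n" for X Y :: "'a mat"
  proof -
    have "(\<Sum>i<n. (X * Y) $$ (i, i)) = (\<Sum>i<n. \<Sum>j<n. X $$ (i, j) * Y $$ (j, i))"
      using X Y by (simp add: scalar_prod_def atLeast0LessThan)
    also have "\<dots> = (\<Sum>j<n. \<Sum>i<n. Y $$ (j, i) * X $$ (i, j))"
      by (subst sum.swap) (simp add: mult.commute)
    also have "\<dots> = (\<Sum>i<n. (Y * X) $$ (i, i))"
      using X Y by (simp add: scalar_prod_def atLeast0LessThan)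
    finally show ?thesis .
  qed
  have "(\<Sum>i<n. (P * M * Q) $$ (i, i)) = (\<Sum>i<n. (Q * (P * M)) $$ (i, i))"
    using assms by (intro comm) auto
  also have "Q * (P * M) = (Q * P) * M" using assms by (intro assoc_mult_mat[symmetric]) auto
  also have "\<dots> = M" using assms by simp
  finally show ?thesis .
qed

text \<open>The characteristic polynomial splits over the complex numbers, and its roots supply the
  diagonal of the Schur form.\<close>

lemma complex_schur:
  fixes A :: "complex mat"
  assumes A: "A \<in> carrier_mat n n"
  obtains B P Q where "similar_mat_wit A B P Q" "upper_triangular B"
    "\<And>e. e \<in> set (diag_mat B) \<Longrightarrow> eigenvalue A e"
proof -
  obtain es where es: "char_poly A = (\<Prod>a\<leftarrow>es. [:- a, 1:])"
    using char_poly_factorized[OF A] by blast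
  obtain B P Q where "schur_decomposition A es = (B, P, Q)" by (metis surj_pair)
  from schur_decomposition[OF A es this]
  have "similar_mat_wit A B P Q" "upper_triangular B" "diag_mat B = es" by auto
  moreover have "eigenvalue A e" if "e \<in> set es" for e
    unfolding eigenvalue_root_char_poly[OF A] es
    using that by (auto simp: poly_prod_list prod_list_zero_iff intro!: image_eqI[of _ _ e])
  ultimately show thesis using that by blast
qed

lemma trace_powers:
  fixes A :: "complex mat"
  assumes A: "A \<in> carrier_mat n n"
  obtains es where "\<And>e. e \<in> set es \<Longrightarrow> eigenvalue A e"
    and "\<And>k. (\<Sum>i<n. (A ^\<^sub>m k) $$ (i, i)) = (\<Sum>e\<leftarrow>es. e ^ k)"
proof -
  obtain B P Q where wit: "similar_mat_wit A B P Q" and ut: "upper_triangular B"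
    and eig: "\<And>e. e \<in> set (diag_mat B) \<Longrightarrow> eigenvalue A e"
    using complex_schur[OF A] by blast
  note dims = similar_mat_witD2[OF A wit]
  have "(\<Sum>i<n. (A ^\<^sub>m k) $$ (i, i)) = (\<Sum>e\<leftarrow>diag_mat B. e ^ k)" for k
  proof -
    have "(\<Sum>i<n. (A ^\<^sub>m k) $$ (i, i)) = (\<Sum>i<n. (P * B ^\<^sub>m k * Q) $$ (i, i))"
      by (simp add: similar_mat_wit_pow_id[OF wit])
    also have "\<dots> = (\<Sum>i<n. (B ^\<^sub>m k) $$ (i, i))"
      using dims by (intro trace_similar) auto
    also have "\<dots> = (\<Sum>i<n. (B $$ (i, i)) ^ k)"
      using dims ut by (intro sum.cong refl, subst upper_triangular_pow[of B n]) auto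
    also have "\<dots> = (\<Sum>e\<leftarrow>diag_mat B. e ^ k)"
      unfolding diag_mat_def using dims
      by (simp add: comp_def sum_list_distinct_conv_sum_set atLeast0LessThan)
    finally show ?thesis .
  qed
  with eig show thesis using that by blast
qed

section \<open>From power sums to the zeta function\<close>

text \<open>Compare logarithmic derivatives: with \<open>L\<close> the series in the exponential,
  the derivative of \<open>Z\<close> is \<open>Z\<close> times that of \<open>L\<close>, while the
  derivative of \<open>P es\<close> is the negative of \<open>P es\<close> times that of
  \<open>L\<close>. So \<open>Z * P es\<close> has derivative 0, and its constant term is 1.\<close>

lemma inverse_exp_power_sums:
  fixes es :: "complex list"
  assumes N: "\<And>l. l > 0 \<Longrightarrow> N l = (\<Sum>e\<leftarrow>es. e ^ l)"
  shows "inverse (fps_exp 1 oo Abs_fps (\<lambda>l. if l = 0 then 0 else N l / of_nat l)) =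
    (\<Prod>e\<leftarrow>es. 1 - fps_const e * fps_X)"
proof -
  define L where "L = Abs_fps (\<lambda>l. if l = 0 then 0 else N l / of_nat l)"
  define Z where "Z = fps_exp 1 oo L"
  \<comment> \<open>The series of \<open>e / (1 - e X)\<close>, the negative logarithmic derivative
    of \<open>1 - e X\<close>.\<close>
  define g where "g e = Abs_fps (\<lambda>n. e ^ Suc n)" for e :: complex
  define P where "P es = (\<Prod>e\<leftarrow>es. 1 - fps_const e * fps_X)" for es :: "complex list"
  have geom: "(1 - fps_const e * fps_X) * g e = fps_const e" for e
  proof (rule fps_ext)
    fix n show "fps_nth ((1 - fps_const e * fps_X) * g e) n = fps_nth (fps_const e) n"
      by (cases n) (simp_all add: g_def algebra_simps)
  qed
  have dP: "fps_deriv (P es) = - (P es * (\<Sum>e\<leftarrow>es. g e))" for es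
  proof (induction es)
    case (Cons e es)
    have "fps_deriv (P (e # es)) = - fps_const e * P es + (1 - fps_const e * fps_X) * fps_deriv (P es)"
      by (simp add: P_def algebra_simps flip: fps_const_neg)
    also have "\<dots> = - ((1 - fps_const e * fps_X) * g e) * P es
        + (1 - fps_const e * fps_X) * (- (P es * (\<Sum>e\<leftarrow>es. g e)))"
      unfolding geom Cons.IH ..
    also have "\<dots> = - (P (e # es) * (\<Sum>e\<leftarrow>e # es. g e))"
      by (simp add: P_def algebra_simps)
    finally show ?case .
  qed (simp add: P_def)
  have dL: "fps_deriv L = (\<Sum>e\<leftarrow>es. g e)"
  proof (rule fps_ext)
    fix n
    have "fps_nth (\<Sum>e\<leftarrow>es. g e) n = (\<Sum>e\<leftarrow>es. e ^ Suc n)" for es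
      by (induction es) (auto simp: g_def)
    moreover have "fps_nth (fps_deriv L) n = N (Suc n)" by (simp add: L_def del: of_nat_Suc)
    ultimately show "fps_nth (fps_deriv L) n = fps_nth (\<Sum>e\<leftarrow>es. g e) n" by (simp add: N)
  qed
  have "fps_deriv Z = Z * fps_deriv L"
    unfolding Z_def by (subst fps_compose_deriv) (simp_all add: L_def)
  then have "fps_deriv (Z * P es) = 0" by (simp add: dP dL algebra_simps)
  then have "Z * P es = fps_const (fps_nth (Z * P es) 0)" by (simp only: fps_deriv_eq_0_iff)
  moreover have "fps_nth (P es) 0 = 1" for es by (induction es) (auto simp: P_def)
  moreover have "fps_nth Z 0 = 1" by (simp add: Z_def)
  ultimately have "Z * P es = 1" by simp
  then show ?thesis unfolding Z_def L_def P_def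
    by (metis fps_inverse_unique)
qed

text \<open>Serves to compare an arbitrary eigenvalue list with the one obtained from a matrix. Read
  as polynomials, both products have the same roots \<open>1 / e\<close>.\<close>

lemma set_eq_of_prod_eq:
  fixes es fs :: "complex list"
  assumes "(\<Prod>e\<leftarrow>es. 1 - fps_const e * fps_X) = (\<Prod>e\<leftarrow>fs. 1 - fps_const e * fps_X)"
    and "e \<in> set fs" "e \<noteq> 0"
  shows "e \<in> set es"
proof -
  define p where "p es = (\<Prod>e\<leftarrow>es. [:1, - e:])" for es :: "complex list"
  have "fps_of_poly (p es) = (\<Prod>e\<leftarrow>es. 1 - fps_const e * fps_X)" for es
  proof (induction es)
    case (Cons e es)
    have "fps_of_poly (p (e # es)) = fps_of_poly [:1, - e:] * fps_of_poly (p es)"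
      unfolding p_def by (simp only: list.map prod_list.Cons fps_of_poly_mult)
    also have "fps_of_poly [:1, - e:] = 1 - fps_const e * fps_X"
      by (simp add: fps_of_poly_pCons)
    finally show ?case using Cons.IH by simp
  qed (simp add: p_def)
  then have "p es = p fs" using assms(1) by (metis fps_of_poly_eq_iff)
  have root: "poly (p es) (1 / e) = 0 \<longleftrightarrow> e \<in> set es" for es
    using assms(3) by (induction es) (auto simp: p_def field_simps)
  show ?thesis using root[of es] root[of fs] assms(2) \<open>p es = p fs\<close> by simp
qed

section \<open>Geodesic cycles and the oriented edge operator\<close>

definition oriented_edges :: "'x set set \<Rightarrow> ('x \<times> 'x) set" where
  "oriented_edges K = {(x, y). x \<noteq> y \<and> {x, y} \<in> K}"

text \<open>The index \<open>l\<close> counts applications of the edge operator: a list of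
  \<open>l + 2\<close> vertices has \<open>l + 1\<close> edges, from the first edge \<open>e\<close>
  to the last edge \<open>e'\<close>.\<close>

definition geodesics_between ::
    "'x set set \<Rightarrow> ('x \<Rightarrow> 'x \<Rightarrow> 'x \<Rightarrow> bool) \<Rightarrow> nat \<Rightarrow> 'x \<times> 'x \<Rightarrow> 'x \<times> 'x \<Rightarrow> 'x list set" where
  "geodesics_between K opp l e e' =
     {xs. length xs = l + 2 \<and> is_geodesic K opp xs \<and> (xs ! 0, xs ! 1) = e \<and> (xs ! l, xs ! Suc l) = e'}"

lemma all_nat_split: "(\<forall>i. P i) \<longleftrightarrow> P 0 \<and> (\<forall>i. P (Suc i))"
  by (metis not0_implies_Suc)

lemma is_geodesic_iff:
  "is_geodesic K opp xs \<longleftrightarrow> is_path K xs \<and>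
     (\<forall>i. Suc (Suc i) < length xs \<longrightarrow> opp (xs ! Suc i) (xs ! i) (xs ! Suc (Suc i)))"
  unfolding is_geodesic_def by (subst all_nat_split) simp

lemma is_geodesic_Cons:
  assumes "length ys \<ge> 2"
  shows "is_geodesic K opp (x # ys) \<longleftrightarrow>
    is_geodesic K opp ys \<and> (x, ys ! 0) \<in> oriented_edges K \<and> opp (ys ! 0) x (ys ! 1)"
proof -
  obtain y z zs where ys: "ys = y # z # zs"
    using assms by (cases ys; cases "tl ys") auto
  have "is_path K (x # ys) \<longleftrightarrow> is_path K ys \<and> (x, y) \<in> oriented_edges K"
    unfolding is_path_def oriented_edges_def
    by (subst all_nat_split) (auto simp: ys)
  then show ?thesis unfolding is_geodesic_iff
    by (subst all_nat_split) (auto simp: ys)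
qed

lemma is_geodesic_pair: "is_geodesic K opp [x, y] \<longleftrightarrow> (x, y) \<in> oriented_edges K"
  by (auto simp: is_geodesic_def is_path_def oriented_edges_def)

lemma geodesics_between_0:
  "geodesics_between K opp 0 e e' = (if e = e' \<and> e \<in> oriented_edges K then {[fst e, snd e]} else {})"
  by (auto simp: geodesics_between_def is_geodesic_pair length_Suc_conv numeral_2_eq_2)

lemma geodesics_between_Suc:
  assumes "(x, y) \<in> oriented_edges K"
  shows "geodesics_between K opp (Suc l) (x, y) e' =
    (\<Union>z\<in>{z. (y, z) \<in> oriented_edges K \<and> opp y x z}. (#) x ` geodesics_between K opp l (y, z) e')"
proof -
  have ed: "(ys ! 0, ys ! 1) \<in> oriented_edges K" if "is_geodesic K opp ys" "length ys = l + 2" for ys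
    using that by (auto simp: is_geodesic_def is_path_def oriented_edges_def)
  show ?thesis
  proof (intro equalityI subsetI)
    fix xs assume xs: "xs \<in> geodesics_between K opp (Suc l) (x, y) e'"
    then obtain ys where ys: "xs = x # ys" "length ys = l + 2"
      by (cases xs) (auto simp: geodesics_between_def)
    then show "xs \<in> (\<Union>z\<in>{z. (y, z) \<in> oriented_edges K \<and> opp y x z}. (#) x ` geodesics_between K opp l (y, z) e')"
      using xs ed[of ys] is_geodesic_Cons[of ys K opp x]
      by (auto simp: geodesics_between_def image_iff)
  next
    fix xs
    assume "xs \<in> (\<Union>z\<in>{z. (y, z) \<in> oriented_edges K \<and> opp y x z}. (#) x ` geodesics_between K opp l (y, z) e')"
    then obtain z ys where "xs = x # ys" "(y, z) \<in> oriented_edges K" "opp y x z"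
      "ys \<in> geodesics_between K opp l (y, z) e'" by blast
    then show "xs \<in> geodesics_between K opp (Suc l) (x, y) e'"
      using assms is_geodesic_Cons[of ys K opp x] by (auto simp: geodesics_between_def)
  qed
qed

lemma finite_geodesics_between:
  assumes "finite (oriented_edges K)" "e \<in> oriented_edges K"
  shows "finite (geodesics_between K opp l e e')"
  using assms(2)
proof (induction l arbitrary: e)
  case (Suc l)
  obtain x y where e: "e = (x, y)" by fastforce
  have "finite {z. (y, z) \<in> oriented_edges K \<and> opp y x z}"
    by (rule finite_subset[OF _ finite_imageI[OF assms(1), of snd]]) force
  then show ?case using Suc unfolding e by (auto simp: geodesics_between_Suc)
qed (simp add: geodesics_between_0)

lemma card_geodesics_between_Suc:
  assumes "finite (oriented_edges K)" "e \<in> oriented_edges K"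
  shows "card (geodesics_between K opp (Suc l) e e') =
    (\<Sum>d | d \<in> oriented_edges K \<and> fst d = snd e \<and> opp (snd e) (fst e) (snd d).
      card (geodesics_between K opp l d e'))"
proof -
  obtain x y where e: "e = (x, y)" by fastforce
  let ?Z = "{z. (y, z) \<in> oriented_edges K \<and> opp y x z}"
  have fin: "finite ?Z"
    by (rule finite_subset[OF _ finite_imageI[OF assms(1), of snd]]) force
  have "card (geodesics_between K opp (Suc l) e e') =
      (\<Sum>z\<in>?Z. card ((#) x ` geodesics_between K opp l (y, z) e'))"
    unfolding e geodesics_between_Suc[OF assms(2)[unfolded e]]
  proof (rule card_UN_disjoint[OF fin])
    show "\<forall>z\<in>?Z. finite ((#) x ` geodesics_between K opp l (y, z) e')"
      using finite_geodesics_between[OF assms(1)] by blast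
  qed (auto simp: geodesics_between_def)
  also have "\<dots> = (\<Sum>z\<in>?Z. card (geodesics_between K opp l (y, z) e'))"
    by (intro sum.cong refl card_image) auto
  also have "\<dots> = (\<Sum>d\<in>Pair y ` ?Z. card (geodesics_between K opp l d e'))"
    by (subst sum.reindex) (auto intro: inj_onI)
  also have "Pair y ` ?Z = {d. d \<in> oriented_edges K \<and> fst d = snd e \<and> opp (snd e) (fst e) (snd d)}"
    by (auto simp: e)
  finally show ?thesis .
qed

text \<open>Appending the vertex \<open>xs ! 1\<close> to a cycle gives a geodesic whose last edge
  equals its first, and \<open>butlast\<close> undoes this. For \<open>l > 0\<close> the entry at
  index 1 survives \<open>butlast\<close>.\<close>

lemma card_geodesic_cycles:
  assumes "finite (oriented_edges K)" "l > 0"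
  shows "card (geodesic_cycles K opp l) = (\<Sum>e\<in>oriented_edges K. card (geodesics_between K opp l e e))"
proof -
  have "bij_betw (\<lambda>xs. xs @ [xs ! 1]) (geodesic_cycles K opp l)
    (\<Union>e\<in>oriented_edges K. geodesics_between K opp l e e)"
  proof (rule bij_betw_byWitness[of _ butlast])
    show "(\<lambda>xs. xs @ [xs ! 1]) ` geodesic_cycles K opp l \<subseteq> (\<Union>e\<in>oriented_edges K. geodesics_between K opp l e e)"
    proof (rule image_subsetI)
      fix xs assume xs: "xs \<in> geodesic_cycles K opp l"
      let ?ys = "xs @ [xs ! 1]"
      have "is_path K ?ys" using xs by (auto simp: geodesic_cycles_def is_geodesic_def)
      then have "(?ys ! 0, ?ys ! Suc 0) \<in> oriented_edges K"
        using xs unfolding is_path_def oriented_edges_def geodesic_cycles_def by auto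
      moreover have "?ys \<in> geodesics_between K opp l (?ys ! 0, ?ys ! Suc 0) (?ys ! 0, ?ys ! Suc 0)"
        using xs assms(2) by (auto simp: geodesics_between_def geodesic_cycles_def nth_append)
      ultimately show "?ys \<in> (\<Union>e\<in>oriented_edges K. geodesics_between K opp l e e)" by blast
    qed
    have *: "butlast ys \<in> geodesic_cycles K opp l \<and> butlast ys @ [butlast ys ! 1] = ys"
      if "ys \<in> geodesics_between K opp l e e" for e ys
    proof -
      have len: "length ys = l + 2" and geo: "is_geodesic K opp ys"
        and eq: "ys ! l = ys ! 0" "ys ! Suc l = ys ! 1"
        using that by (auto simp: geodesics_between_def)
      have "last ys = ys ! Suc l" using len by (subst last_conv_nth) auto
      moreover have "butlast ys ! 1 = ys ! 1" using len assms(2) by (simp add: nth_butlast)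
      ultimately have a: "butlast ys @ [butlast ys ! 1] = ys"
        using eq len append_butlast_last_id[of ys] by force
      moreover have "butlast ys ! l = butlast ys ! 0" using eq len by (simp add: nth_butlast)
      ultimately show ?thesis using geo len by (simp add: geodesic_cycles_def)
    qed
    then show "butlast ` (\<Union>e\<in>oriented_edges K. geodesics_between K opp l e e) \<subseteq> geodesic_cycles K opp l"
      and "\<forall>ys\<in>\<Union>e\<in>oriented_edges K. geodesics_between K opp l e e. butlast ys @ [butlast ys ! 1] = ys"
      by blast+
  qed auto
  then have "card (geodesic_cycles K opp l) = card (\<Union>e\<in>oriented_edges K. geodesics_between K opp l e e)"
    by (rule bij_betw_same_card)
  also have "\<dots> = (\<Sum>e\<in>oriented_edges K. card (geodesics_between K opp l e e))"
  proof (rule card_UN_disjoint[OF assms(1)])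
    show "\<forall>e\<in>oriented_edges K. finite (geodesics_between K opp l e e)"
      using finite_geodesics_between[OF assms(1)] by blast
  qed (auto simp: geodesics_between_def)
  finally show ?thesis .
qed

text \<open>The reduction to eigenfunctions. Powers of the transition matrix \<open>A\<close>
  between edges count geodesics, so their traces count geodesic cycles, and the nonzero eigenvalues
  of \<open>A\<close> factor the inverse zeta function. This yields one eigenvalue list;
  \<open>set_eq_of_prod_eq\<close> carries \<open>P\<close> over to every other.\<close>

theorem eigenvalue_list_of_eigenfunctions:
  assumes fin: "finite (oriented_edges K)"
    and eig: "\<And>c f. c \<noteq> 0 \<Longrightarrow> \<exists>e\<in>oriented_edges K. f e \<noteq> 0 \<Longrightarrow>
      (\<And>x y. (x, y) \<in> oriented_edges K \<Longrightarrow>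
        c * f (x, y) = (\<Sum>z | (y, z) \<in> oriented_edges K \<and> opp y x z. f (y, z))) \<Longrightarrow> P c"
  shows "(\<exists>es. eigenvalue_list K opp es) \<and> (\<forall>es. eigenvalue_list K opp es \<longrightarrow> (\<forall>e\<in>set es. P e))"
proof -
  define n where "n = card (oriented_edges K)"
  obtain h where h: "bij_betw h {..<n} (oriented_edges K)"
    using ex_bij_betw_nat_finite[OF fin] by (auto simp: n_def atLeast0LessThan)
  define R where "R e d \<longleftrightarrow> fst d = snd e \<and> opp (snd e) (fst e) (snd d)" for e d :: "'a \<times> 'a"
  define A :: "complex mat" where "A = mat n n (\<lambda>(i, j). if R (h i) (h j) then 1 else 0)"
  have A: "A \<in> carrier_mat n n" by (simp add: A_def)
  have hE: "h i \<in> oriented_edges K" if "i < n" for i using h that by (auto simp: bij_betw_def)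
  have sumR: "(\<Sum>d | d \<in> oriented_edges K \<and> R e d. F d) = (\<Sum>j<n. if R e (h j) then F (h j) else 0)"
    for e and F :: "'a \<times> 'a \<Rightarrow> complex"
  proof -
    have "(\<Sum>d | d \<in> oriented_edges K \<and> R e d. F d) = (\<Sum>d\<in>oriented_edges K. if R e d then F d else 0)"
      using fin by (simp add: sum.inter_filter)
    also have "\<dots> = (\<Sum>j<n. if R e (h j) then F (h j) else 0)"
      by (rule sum.reindex_bij_betw[OF h, symmetric])
    finally show ?thesis .
  qed
  have pow: "(A ^\<^sub>m l) $$ (i, j) = of_nat (card (geodesics_between K opp l (h i) (h j)))"
    if "i < n" "j < n" for l i j
    using that(1)
  proof (induction l arbitrary: i)
    case 0
    have "h i = h j \<longleftrightarrow> i = j" using h 0 that by (auto simp: bij_betw_def inj_on_def)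
    then show ?case using A 0 that hE by (auto simp: geodesics_between_0)
  next
    case (Suc l)
    have "(A ^\<^sub>m Suc l) $$ (i, j) = (A * A ^\<^sub>m l) $$ (i, j)"
      by (simp only: pow_mat_Suc_left[OF A])
    also have "\<dots> = (\<Sum>m<n. A $$ (i, m) * (A ^\<^sub>m l) $$ (m, j))"
      using A Suc.prems that by (simp add: scalar_prod_def atLeast0LessThan)
    also have "\<dots> = (\<Sum>m<n. if R (h i) (h m) then of_nat (card (geodesics_between K opp l (h m) (h j))) else 0)"
      using Suc by (intro sum.cong refl) (auto simp: A_def)
    also have "\<dots> = (\<Sum>d | d \<in> oriented_edges K \<and> R (h i) d. of_nat (card (geodesics_between K opp l d (h j))))"
      by (rule sumR[symmetric])
    also have "\<dots> = of_nat (card (geodesics_between K opp (Suc l) (h i) (h j)))"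
      unfolding card_geodesics_between_Suc[OF fin hE[OF Suc.prems]] R_def by simp
    finally show ?case .
  qed
  obtain es0 where es0: "\<And>e. e \<in> set es0 \<Longrightarrow> eigenvalue A e"
    "\<And>k. (\<Sum>i<n. (A ^\<^sub>m k) $$ (i, i)) = (\<Sum>e\<leftarrow>es0. e ^ k)"
    using trace_powers[OF A] by metis
  \<comment> \<open>Zero eigenvalues contribute nothing to the traces of positive powers, and an
    eigenvalue list must not contain them.\<close>
  define es where "es = filter (\<lambda>e. e \<noteq> 0) es0"
  have N: "of_nat (card (geodesic_cycles K opp l)) = (\<Sum>e\<leftarrow>es. e ^ l)" if l: "l > 0" for l
  proof -
    have "of_nat (card (geodesic_cycles K opp l)) =
        (\<Sum>e\<in>oriented_edges K. of_nat (card (geodesics_between K opp l e e)) :: complex)"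
      by (simp add: card_geodesic_cycles[OF fin l])
    also have "\<dots> = (\<Sum>i<n. of_nat (card (geodesics_between K opp l (h i) (h i))))"
      by (rule sum.reindex_bij_betw[OF h, symmetric])
    also have "\<dots> = (\<Sum>e\<leftarrow>es0. e ^ l)" by (simp add: pow flip: es0(2))
    also have "\<dots> = (\<Sum>e\<leftarrow>es. e ^ l)" unfolding es_def using l by (induction es0) auto
    finally show ?thesis .
  qed
  have zeta: "inverse (edge_zeta K opp) = (\<Prod>e\<leftarrow>es. 1 - fps_const e * fps_X)"
    unfolding edge_zeta_def by (rule inverse_exp_power_sums) (rule N)
  have Pes: "P c" if c: "c \<in> set es" for c
  proof -
    have "c \<noteq> 0" "eigenvalue A c" using c es0 by (auto simp: es_def)
    then obtain v where v: "v \<in> carrier_vec n" "v \<noteq> 0\<^sub>v n" "A *\<^sub>v v = c \<cdot>\<^sub>v v"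
      using A by (auto simp: eigenvalue_def eigenvector_def)
    \<comment> \<open>The eigenvector, read as a function on edges through the enumeration
      \<open>h\<close>.\<close>
    define f where "f e = v $ (inv_into {..<n} h e)" for e
    have fh: "f (h i) = v $ i" if "i < n" for i
      using that h by (simp add: f_def bij_betw_def inv_into_f_f)
    show ?thesis
    proof (rule eig[OF \<open>c \<noteq> 0\<close>])
      obtain i where "i < n" "v $ i \<noteq> 0" using v by (metis carrier_vecD dim_vec index_zero_vec(1) index_zero_vec(2) eq_vecI)
      then show "\<exists>e\<in>oriented_edges K. f e \<noteq> 0" using fh hE by metis
    next
      fix x y assume xy: "(x, y) \<in> oriented_edges K"
      then obtain i where i: "i < n" "h i = (x, y)" using h by (metis bij_betw_def imageE lessThan_iff)
      have "c * f (x, y) = (c \<cdot>\<^sub>v v) $ i" using i v fh[OF i(1)] by simp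
      also have "\<dots> = (\<Sum>j<n. A $$ (i, j) * v $ j)" unfolding v(3)[symmetric]
        using A v(1) i(1) by (auto simp: scalar_prod_def atLeast0LessThan)
      also have "\<dots> = (\<Sum>j<n. if R (x, y) (h j) then f (h j) else 0)"
        using i fh by (intro sum.cong refl) (auto simp: A_def)
      also have "\<dots> = (\<Sum>d | d \<in> oriented_edges K \<and> R (x, y) d. f d)" by (simp add: sumR)
      also have "{d. d \<in> oriented_edges K \<and> R (x, y) d} = Pair y ` {z. (y, z) \<in> oriented_edges K \<and> opp y x z}"
        by (auto simp: R_def)
      also have "(\<Sum>d\<in>Pair y ` {z. (y, z) \<in> oriented_edges K \<and> opp y x z}. f d) =
          (\<Sum>z | (y, z) \<in> oriented_edges K \<and> opp y x z. f (y, z))"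
        by (subst sum.reindex) (auto intro: inj_onI)
      finally show "c * f (x, y) = (\<Sum>z | (y, z) \<in> oriented_edges K \<and> opp y x z. f (y, z))" .
    qed
  qed
  have "eigenvalue_list K opp es" using zeta by (auto simp: eigenvalue_list_def es_def)
  moreover have "P e" if fs: "eigenvalue_list K opp fs" "e \<in> set fs" for fs e
  proof (rule Pes, rule set_eq_of_prod_eq[of es fs])
    show "(\<Prod>e\<leftarrow>es. 1 - fps_const e * fps_X) = (\<Prod>e\<leftarrow>fs. 1 - fps_const e * fps_X)"
      using fs zeta by (simp add: eigenvalue_list_def)
  qed (use fs in \<open>auto simp: eigenvalue_list_def\<close>)
  ultimately show ?thesis by blast
qed

section \<open>Eigenvalues from determinants\<close>

lemma det_eq_prod_eigenvalues:
  fixes A :: "complex mat"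
  assumes A: "A \<in> carrier_mat n n"
  obtains es where "\<And>e. e \<in> set es \<Longrightarrow> eigenvalue A e" and "det A = prod_list es"
proof -
  obtain B P Q where wit: "similar_mat_wit A B P Q" and ut: "upper_triangular B"
    and eig: "\<And>e. e \<in> set (diag_mat B) \<Longrightarrow> eigenvalue A e"
    using complex_schur[OF A] by blast
  have "det A = det B" using wit by (intro det_similar) (auto simp: similar_mat_def)
  also have "\<dots> = prod_list (diag_mat B)"
    using det_upper_triangular[OF ut] similar_mat_witD2[OF A wit] by blast
  finally have "det A = prod_list (diag_mat B)" .
  with eig show thesis using that by blast
qed

lemma scalar_mat_eqI:
  fixes A :: "'a::comm_ring_1 mat"
  assumes A: "A \<in> carrier_mat n n"
    and eq: "\<And>w. w \<in> carrier_vec n \<Longrightarrow> A *\<^sub>v w = c \<cdot>\<^sub>v w"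
  shows "A = c \<cdot>\<^sub>m 1\<^sub>m n"
proof (rule eq_matI)
  fix i j assume "i < dim_row (c \<cdot>\<^sub>m 1\<^sub>m n :: 'a mat)" "j < dim_col (c \<cdot>\<^sub>m 1\<^sub>m n :: 'a mat)"
  then have ij: "i < n" "j < n" by auto
  have "A $$ (i, j) = (A *\<^sub>v unit_vec n j) $ i" using A ij by simp
  also have "\<dots> = (c \<cdot>\<^sub>v unit_vec n j) $ i" by (subst eq) auto
  finally show "A $$ (i, j) = (c \<cdot>\<^sub>m 1\<^sub>m n) $$ (i, j)" using ij by simp
qed (use A in auto)

text \<open>
  The determinant of the restriction of \<open>(s1 \<circ> s2)\<^sup>3\<close> to \<open>E\<close> is a power of \<open>c\<close>; it is also the cube
  of the product of the determinants of the restrictions of \<open>s1\<close> and \<open>s2\<close>.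
\<close>

lemma scalar_cube_of_product:
  fixes scale :: "complex \<Rightarrow> 'b::ab_group_add \<Rightarrow> 'b"
  assumes vs: "vector_space scale" and q: "q > 0"
    and E: "module.subspace scale E" "E \<noteq> {0}" and F: "finite F" "E \<subseteq> module.span scale F"
    and lin: "\<And>i. Vector_Spaces.linear scale scale (s i)"
    and inv: "\<And>i v. v \<in> E \<Longrightarrow> s i v \<in> E"
    and c: "c \<noteq> 0"
    and cube: "\<And>v. v \<in> E \<Longrightarrow> (s True \<circ> s False) ((s True \<circ> s False) ((s True \<circ> s False) v)) = scale c v"
    and eig: "\<And>i \<mu> v. \<mu> \<noteq> 0 \<Longrightarrow> v \<in> E \<Longrightarrow> v \<noteq> 0 \<Longrightarrow> s i v = scale \<mu> v \<Longrightarrow>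
      root_of_unity_times_power q \<mu>"
  shows "root_of_unity_times_power q c"
proof -
  interpret vector_space scale by (rule vs)
  obtain Bs where Bs: "Bs \<subseteq> E" "independent Bs" "E \<subseteq> span Bs"
    by (rule basis_exists) blast
  have spanB: "span Bs = E" using Bs E by (simp add: span_subspace)
  \<comment> \<open>\<open>E\<close> lies in the span of a finite set, so it is
    finite-dimensional.\<close>
  have "Bs \<subseteq> span F" using Bs(1) F(2) by blast
  then have finB: "finite Bs" using independent_span_bound[OF F(1) Bs(2)] by blast
  define d where "d = card Bs"
  obtain b where b: "bij_betw b {..<d} Bs"
    using ex_bij_betw_nat_finite[OF finB] by (auto simp: d_def atLeast0LessThan)
  have d: "d > 0"
  proof (rule ccontr)
    assume "\<not> d > 0"
    then have "Bs = {}" using finB by (simp add: d_def)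
    then show False using spanB E(2) by simp
  qed
  \<comment> \<open>The coordinate isomorphism from column vectors of length \<open>d\<close> onto
    \<open>E\<close>.\<close>
  define L where "L w = (\<Sum>i<d. scale (w $ i) (b i))" for w :: "complex vec"
  have LE: "L w \<in> E" for w
    unfolding L_def using b Bs E by (intro subspace_sum subspace_scale) (auto simp: bij_betw_def)
  have L_smult: "L (k \<cdot>\<^sub>v w) = scale k (L w)" if "w \<in> carrier_vec d" for k w
    using that by (simp add: L_def scale_sum_right)
  have L_inj: "w = w'" if w: "w \<in> carrier_vec d" "w' \<in> carrier_vec d" and eq: "L w = L w'" for w w'
  proof -
    have binv: "inv_into {..<d} b (b i) = i" if "i < d" for i
      using b that by (simp add: bij_betw_def inv_into_f_f)
    define u where "u v = w $ (inv_into {..<d} b v) - w' $ (inv_into {..<d} b v)" for v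
    have "(\<Sum>v\<in>Bs. scale (u v) v) = (\<Sum>i<d. scale (u (b i)) (b i))"
      by (rule sum.reindex_bij_betw[OF b, symmetric])
    also have "\<dots> = L w - L w'"
      by (simp add: L_def u_def binv scale_left_diff_distrib sum_subtractf)
    finally have "(\<Sum>v\<in>Bs. scale (u v) v) = 0" using eq by simp
    then have "u v = 0" if "v \<in> Bs" for v
      using independentD[OF Bs(2) finB subset_refl] that by blast
    then have "w $ i = w' $ i" if "i < d" for i
      using b that binv[OF that] unfolding u_def by (force simp: bij_betw_def)
    then show ?thesis using w by auto
  qed
  \<comment> \<open>The matrix of the restriction of \<open>s i\<close> to \<open>E\<close>, which
    exists because \<open>E\<close> is invariant.\<close>
  define M where "M i = mat d d (\<lambda>(k, j). representation Bs (s i (b j)) (b k))" for i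
  have M: "M i \<in> carrier_mat d d" for i by (simp add: M_def)
  have LM: "L (M i *\<^sub>v w) = s i (L w)" if w: "w \<in> carrier_vec d" for i w
  proof -
    interpret si: Vector_Spaces.linear scale scale "s i" by (rule lin)
    have sb: "s i (b j) = (\<Sum>k<d. scale (M i $$ (k, j)) (b k))" if "j < d" for j
    proof -
      have "s i (b j) \<in> span Bs" using that b Bs inv spanB by (auto simp: bij_betw_def)
      then have "s i (b j) = (\<Sum>v\<in>Bs. scale (representation Bs (s i (b j)) v) v)"
        using sum_representation_eq[OF Bs(2) _ finB subset_refl] by metis
      also have "\<dots> = (\<Sum>k<d. scale (representation Bs (s i (b j)) (b k)) (b k))"
        by (rule sum.reindex_bij_betw[OF b, symmetric])
      finally show ?thesis using that by (simp add: M_def)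
    qed
    have "s i (L w) = (\<Sum>j<d. scale (w $ j) (s i (b j)))"
      by (simp add: L_def si.sum si.scale)
    also have "\<dots> = (\<Sum>j<d. \<Sum>k<d. scale (M i $$ (k, j) * w $ j) (b k))"
      by (intro sum.cong refl) (simp add: sb scale_sum_right mult.commute)
    also have "\<dots> = (\<Sum>k<d. scale (\<Sum>j<d. M i $$ (k, j) * w $ j) (b k))"
      by (subst sum.swap) (simp add: scale_sum_left)
    also have "\<dots> = L (M i *\<^sub>v w)"
      unfolding L_def using M[of i] w
      by (intro sum.cong refl) (auto simp: scalar_prod_def atLeast0LessThan)
    finally show ?thesis by simp
  qed
  define N where "N = M True * M False"
  have N: "N \<in> carrier_mat d d" unfolding N_def by (rule mult_carrier_mat[OF M M])
  have LN: "L (N *\<^sub>v w) = (s True \<circ> s False) (L w)" if "w \<in> carrier_vec d" for w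
    using that M[of True] M[of False] by (simp add: N_def LM assoc_mult_mat_vec[of _ d d _ d])
  have "(N * (N * N)) *\<^sub>v w = c \<cdot>\<^sub>v w" if w: "w \<in> carrier_vec d" for w
  proof (rule L_inj)
    have "(N * (N * N)) *\<^sub>v w = N *\<^sub>v (N *\<^sub>v (N *\<^sub>v w))"
      using N w by (simp add: assoc_mult_mat_vec[of _ d d _ d])
    then show "L ((N * (N * N)) *\<^sub>v w) = L (c \<cdot>\<^sub>v w)"
      using N w cube[OF LE, of w] by (simp add: LN L_smult del: comp_apply)
  qed (use mult_carrier_mat[OF N mult_carrier_mat[OF N N]] w in auto)
  then have "N * (N * N) = c \<cdot>\<^sub>m 1\<^sub>m d" using N by (intro scalar_mat_eqI) auto
  then have "det (N * (N * N)) = c ^ d" by simp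
  moreover have "det (N * (N * N)) = (det (M True) * det (M False)) ^ 3"
  proof -
    have "det (N * (N * N)) = det N * (det N * det N)"
      by (simp only: det_mult[OF N mult_carrier_mat[OF N N]] det_mult[OF N N])
    then show ?thesis unfolding N_def det_mult[OF M M] by (simp add: power3_eq_cube mult.assoc)
  qed
  ultimately have cd: "c ^ d = (det (M True) * det (M False)) ^ 3" by simp
  \<comment> \<open>As \<open>c \<noteq> 0\<close>, both determinants are nonzero; hence so are all
    eigenvalues of \<open>M i\<close>, as \<open>eig\<close> demands.\<close>
  have det0: "det (M i) \<noteq> 0" for i using cd c by (cases i) auto
  have "root_of_unity_times_power q (det (M i))" for i
  proof -
    obtain es where es: "\<And>e. e \<in> set es \<Longrightarrow> eigenvalue (M i) e" "det (M i) = prod_list es"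
      using det_eq_prod_eigenvalues[OF M] by metis
    have "root_of_unity_times_power q e" if e: "e \<in> set es" for e
    proof -
      obtain w where w: "w \<in> carrier_vec d" "w \<noteq> 0\<^sub>v d" "M i *\<^sub>v w = e \<cdot>\<^sub>v w"
        using es(1)[OF e] M[of i] by (auto simp: eigenvalue_def eigenvector_def)
      show ?thesis
      proof (rule eig[of e "L w" i])
        show "e \<noteq> 0" using det0[of i] e es(2) by (auto simp: prod_list_zero_iff)
        show "L w \<in> E" by (rule LE)
        have "L (0\<^sub>v d) = 0" by (simp add: L_def)
        then show "L w \<noteq> 0" using L_inj[of w "0\<^sub>v d"] w by auto
        show "s i (L w) = scale e (L w)" using LM[OF w(1), of i] w L_smult by simp
      qed
    qed
    then show ?thesis unfolding es(2) by (rule root_of_unity_times_power_prod_list[OF q])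
  qed
  then have "root_of_unity_times_power q (c ^ d)"
    unfolding cd by (intro root_of_unity_times_power_power root_of_unity_times_power_mult q) auto
  then show ?thesis by (rule root_of_unity_times_power_root[OF q d])
qed

section \<open>Operators defined by relations\<close>

text \<open>Values off \<open>F\<close> are set to 0, so that the operator maps into the functions
  supported on \<open>F\<close>, a finite-dimensional space when \<open>F\<close> is finite.\<close>

definition rel_op :: "'a set \<Rightarrow> ('a \<Rightarrow> 'a \<Rightarrow> bool) \<Rightarrow> ('a \<Rightarrow> complex) \<Rightarrow> 'a \<Rightarrow> complex" where
  "rel_op F R f x = (if x \<in> F then \<Sum>y | y \<in> F \<and> R x y. f y else 0)"

text \<open>The composite counts each \<open>z\<close> once for every intermediate \<open>y\<close>.
  Uniqueness of \<open>y\<close> makes all multiplicities 1, so the composite is again the operator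
  of a relation.\<close>

lemma rel_op_comp:
  assumes F: "finite F"
    and uniq: "\<And>x y y' z. x \<in> F \<Longrightarrow> y \<in> F \<Longrightarrow> y' \<in> F \<Longrightarrow> z \<in> F \<Longrightarrow>
      R x y \<Longrightarrow> S y z \<Longrightarrow> R x y' \<Longrightarrow> S y' z \<Longrightarrow> y = y'"
  shows "rel_op F R (rel_op F S f) = rel_op F (\<lambda>x z. \<exists>y\<in>F. R x y \<and> S y z) f"
proof
  fix x
  show "rel_op F R (rel_op F S f) x = rel_op F (\<lambda>x z. \<exists>y\<in>F. R x y \<and> S y z) f x"
  proof (cases "x \<in> F")
    case x: True
    have eq: "{z. z \<in> F \<and> (\<exists>y\<in>F. R x y \<and> S y z)} = (\<Union>y\<in>{y. y \<in> F \<and> R x y}. {z. z \<in> F \<and> S y z})"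
      by auto
    have "(\<Sum>z | z \<in> F \<and> (\<exists>y\<in>F. R x y \<and> S y z). f z) =
        (\<Sum>y | y \<in> F \<and> R x y. \<Sum>z | z \<in> F \<and> S y z. f z)"
      unfolding eq using F uniq[OF x] by (intro sum.UNION_disjoint) auto
    also have "\<dots> = (\<Sum>y | y \<in> F \<and> R x y. rel_op F S f y)"
      by (intro sum.cong refl) (auto simp: rel_op_def)
    finally show ?thesis using x by (simp add: rel_op_def)
  qed (simp add: rel_op_def)
qed

lemma rel_op_cong:
  assumes "\<And>x y. x \<in> F \<Longrightarrow> y \<in> F \<Longrightarrow> R x y \<longleftrightarrow> S x y"
  shows "rel_op F R = rel_op F S"
  unfolding rel_op_def fun_eq_iff using assms by (auto intro!: sum.cong)

definition fun_scale :: "complex \<Rightarrow> ('a \<Rightarrow> complex) \<Rightarrow> 'a \<Rightarrow> complex" where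
  "fun_scale c f = (\<lambda>x. c * f x)"

lemma vector_space_fun_scale: "vector_space fun_scale"
  by unfold_locales (auto simp: fun_scale_def fun_eq_iff algebra_simps)

lemma linear_rel_op: "Vector_Spaces.linear fun_scale fun_scale (rel_op F R)"
proof -
  interpret vector_space fun_scale by (rule vector_space_fun_scale)
  show ?thesis
    by unfold_locales
      (auto simp: rel_op_def fun_scale_def fun_eq_iff sum.distrib sum_distrib_left)
qed

lemma rel_op_scale: "rel_op F R (fun_scale c f) = fun_scale c (rel_op F R f)"
  by (auto simp: rel_op_def fun_scale_def fun_eq_iff sum_distrib_left)

lemma rel_op_add: "rel_op F R (f + g) = rel_op F R f + rel_op F R g"
  by (auto simp: rel_op_def fun_eq_iff sum.distrib)

lemma rel_op_restrict: "rel_op F R (\<lambda>x. if x \<in> F then f x else 0) = rel_op F R f"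
  by (auto simp: rel_op_def fun_eq_iff intro!: sum.cong)

text \<open>Supplies the finite spanning set that \<open>scalar_cube_of_product\<close> asks
  for.\<close>

lemma span_indicators:
  assumes "finite F" "\<And>x. x \<notin> F \<Longrightarrow> f x = 0"
  shows "f \<in> module.span fun_scale ((\<lambda>a x. if x = a then 1 else 0) ` F)"
proof -
  interpret vector_space fun_scale by (rule vector_space_fun_scale)
  have "f = (\<Sum>a\<in>F. fun_scale (f a) (\<lambda>x. if x = a then 1 else 0))"
  proof
    fix x
    have "(\<Sum>a\<in>F. fun_scale (f a) (\<lambda>x. if x = a then 1 else 0)) x =
        (\<Sum>a\<in>F. fun_scale (f a) (\<lambda>x. if x = a then 1 else 0) x)"
      using assms(1) by (induction F rule: finite_induct) auto
    also have "\<dots> = f x" using assms by (simp add: fun_scale_def if_distrib cong: if_cong)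
    finally show "f x = (\<Sum>a\<in>F. fun_scale (f a) (\<lambda>x. if x = a then 1 else 0)) x" by simp
  qed
  moreover have "\<dots> \<in> span ((\<lambda>a x. if x = a then 1 else 0) ` F)"
    by (intro span_sum span_scale span_base) auto
  ultimately show ?thesis by simp
qed

text \<open>
  \<open>g\<close> and \<open>h\<close> are the two halves of an eigenfunction of the oriented edge operator, which
  interchanges two kinds of edges.
\<close>

lemma alternating_eigenvalue:
  fixes s :: "bool \<Rightarrow> ('a \<Rightarrow> complex) \<Rightarrow> 'a \<Rightarrow> complex" and F :: "'a set"
  assumes F: "finite F" and q: "q > 0" and s: "\<And>i. s i = rel_op F (R i)"
    and c: "c \<noteq> 0" and g: "x0 \<in> F" "g x0 \<noteq> 0 \<or> h x0 \<noteq> 0"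
    and gh: "\<And>x. x \<in> F \<Longrightarrow> c * g x = s True h x" "\<And>x. x \<in> F \<Longrightarrow> c * h x = s False g x"
    and comm: "\<And>i f. s i ((s True \<circ> s False) ((s True \<circ> s False) ((s True \<circ> s False) f))) =
      (s True \<circ> s False) ((s True \<circ> s False) ((s True \<circ> s False) (s i f)))"
    and eig: "\<And>i \<mu> v. \<mu> \<noteq> 0 \<Longrightarrow> (\<And>x. x \<notin> F \<Longrightarrow> v x = 0) \<Longrightarrow> v \<noteq> (\<lambda>_. 0) \<Longrightarrow>
      (s True \<circ> s False) ((s True \<circ> s False) ((s True \<circ> s False) v)) = fun_scale (c ^ 6) v \<Longrightarrow>
      s i v = fun_scale \<mu> v \<Longrightarrow> root_of_unity_times_power q \<mu>"
  shows "root_of_unity_times_power q c"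
proof -
  interpret vector_space fun_scale by (rule vector_space_fun_scale)
  define t where "t = s True \<circ> s False"
  note scl = rel_op_scale[of F]
  have t_scale: "t (fun_scale k f) = fun_scale k (t f)" for k f by (simp add: t_def s scl)
  have t_add: "t (f + f') = t f + t f'" for f f'
    by (simp add: t_def s rel_op_add)
  have supp: "s i f x = 0" if "x \<notin> F" for i f x using that by (simp add: s rel_op_def)
  \<comment> \<open>The eigenspace of the full twist for \<open>c ^ 6\<close>. It will contain
    \<open>g'\<close>, which \<open>t\<close> multiplies by \<open>c ^ 2\<close>.\<close>
  define E where "E = {v. (\<forall>x. x \<notin> F \<longrightarrow> v x = 0) \<and> t (t (t v)) = fun_scale (c ^ 6) v}"
  define g' where "g' = (\<lambda>x. if x \<in> F then g x else 0)"
  define h' where "h' = (\<lambda>x. if x \<in> F then h x else 0)"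
  have g': "fun_scale c g' = s True h'"
    using gh(1) supp[of _ True] unfolding h'_def s rel_op_restrict
    by (auto simp: g'_def fun_scale_def fun_eq_iff)
  have h': "fun_scale c h' = s False g'"
    using gh(2) supp[of _ False] unfolding g'_def s rel_op_restrict
    by (auto simp: h'_def fun_scale_def fun_eq_iff)
  have "t g' = s True (fun_scale c h')" unfolding t_def h' by simp
  also have "\<dots> = fun_scale (c ^ 2) g'"
    by (simp add: s scl power2_eq_square g'[unfolded s, symmetric])
  finally have tg: "t g' = fun_scale (c ^ 2) g'" .
  have gE: "g' \<in> E"
    by (simp add: E_def tg t_scale flip: power_add) (simp add: g'_def)
  \<comment> \<open>If \<open>g'\<close> vanished, so would its image \<open>fun_scale c h'\<close>
    under \<open>s False\<close>, contradicting the choice of \<open>x0\<close>.\<close>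
  have g'0: "g' \<noteq> (\<lambda>_. 0)"
  proof
    assume z: "g' = (\<lambda>_. 0)"
    have "fun_scale c h' = (\<lambda>_. 0)" unfolding h' z by (simp add: s rel_op_def fun_eq_iff)
    then have "h' = (\<lambda>_. 0)" using c by (auto simp: fun_scale_def fun_eq_iff)
    then have "g' x0 = 0" "h' x0 = 0" using z by auto
    then show False using g by (auto simp: g'_def h'_def)
  qed
  show ?thesis
  proof (rule root_of_unity_times_power_root[OF q, of 6])
    show "root_of_unity_times_power q (c ^ 6)"
    proof (rule scalar_cube_of_product[where s = s and E = E and scale = fun_scale])
      show "subspace E"
      proof (rule subspaceI)
        have "t 0 = 0" using t_scale[of 0 0] by simp
        then show "0 \<in> E" by (simp add: E_def)
        show "x + y \<in> E" if "x \<in> E" "y \<in> E" for x y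
          using that by (simp add: E_def t_add scale_right_distrib)
        show "fun_scale k x \<in> E" if "x \<in> E" for k x
        proof -
          have "fun_scale k x y = 0" if "y \<notin> F" for y
            using that \<open>x \<in> E\<close> by (simp add: E_def fun_scale_def)
          then show ?thesis using \<open>x \<in> E\<close> by (simp add: E_def t_scale mult.commute)
        qed
      qed
      show "E \<noteq> {0}" using gE g'0 by (auto simp: zero_fun_def)
      show "finite ((\<lambda>a x. if x = a then 1 else 0 :: complex) ` F)" using F by simp
      show "E \<subseteq> span ((\<lambda>a x. if x = a then 1 else 0) ` F)"
        using span_indicators[OF F] by (auto simp: E_def)
      show "Vector_Spaces.linear fun_scale fun_scale (s i)" for i unfolding s by (rule linear_rel_op)
      \<comment> \<open>An operator that commutes with the full twist preserves its
        eigenspaces.\<close>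
      show "s i v \<in> E" if "v \<in> E" for i v
        using that comm[of i v, folded t_def] by (auto simp: E_def supp) (simp add: s scl)
      show "(s True \<circ> s False) ((s True \<circ> s False) ((s True \<circ> s False) v)) = fun_scale (c ^ 6) v"
        if "v \<in> E" for v using that by (simp add: E_def t_def)
      show "root_of_unity_times_power q \<mu>"
        if "\<mu> \<noteq> 0" "v \<in> E" "v \<noteq> 0" "s i v = fun_scale \<mu> v" for i \<mu> v
        using that by (intro eig[of \<mu> v i]) (auto simp: E_def t_def zero_fun_def)
    qed (use c q vector_space_fun_scale in auto)
  qed simp
qed

section \<open>Braid and commutation relations\<close>

text \<open>The full twist is a word in two commuting operators, so it commutes with both. This case
  serves the edges between two factors of a join.\<close>

lemma commuting_eigenvalue:
  fixes s :: "bool \<Rightarrow> ('a \<Rightarrow> complex) \<Rightarrow> 'a \<Rightarrow> complex" and F :: "'a set"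
  assumes F: "finite F" and q: "q > 0" and s: "\<And>i. s i = rel_op F (R i)"
    and c: "c \<noteq> 0" and g: "x0 \<in> F" "g x0 \<noteq> 0 \<or> h x0 \<noteq> 0"
    and gh: "\<And>x. x \<in> F \<Longrightarrow> c * g x = s True h x" "\<And>x. x \<in> F \<Longrightarrow> c * h x = s False g x"
    and comm: "\<And>f. s True (s False f) = s False (s True f)"
    and eig: "\<And>i \<mu> v. \<mu> \<noteq> 0 \<Longrightarrow> (\<And>x. x \<notin> F \<Longrightarrow> v x = 0) \<Longrightarrow> v \<noteq> (\<lambda>_. 0) \<Longrightarrow>
      s i v = fun_scale \<mu> v \<Longrightarrow> root_of_unity_times_power q \<mu>"
  shows "root_of_unity_times_power q c"
proof (rule alternating_eigenvalue[where s = s and F = F and R = R and c = c and g = g and h = h and ?x0.0 = x0 and q = q,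
      OF F q s c g gh])
  show "s i ((s True \<circ> s False) ((s True \<circ> s False) ((s True \<circ> s False) f))) =
      (s True \<circ> s False) ((s True \<circ> s False) ((s True \<circ> s False) (s i f)))" for i f
    by (cases i) (simp_all add: comm)
  show "root_of_unity_times_power q \<mu>" if "\<mu> \<noteq> 0" "\<And>x. x \<notin> F \<Longrightarrow> v x = 0" "v \<noteq> (\<lambda>_. 0)"
    "s i v = fun_scale \<mu> v" for i \<mu> v
    by (rule eig[OF that])
qed

text \<open>Conjugation by the half twist \<open>D\<close> interchanges \<open>s True\<close> and
  \<open>s False\<close>, by the braid relation. So the full twist, which is the square of
  \<open>D\<close>, commutes with both, and knowing the eigenvalues of \<open>s True\<close>
  suffices.\<close>

lemma braid_eigenvalue:
  fixes s :: "bool \<Rightarrow> ('a \<Rightarrow> complex) \<Rightarrow> 'a \<Rightarrow> complex" and F :: "'a set"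
  assumes F: "finite F" and q: "q > 0" and s: "\<And>i. s i = rel_op F (R i)"
    and c: "c \<noteq> 0" and g: "x0 \<in> F" "g x0 \<noteq> 0 \<or> h x0 \<noteq> 0"
    and gh: "\<And>x. x \<in> F \<Longrightarrow> c * g x = s True h x" "\<And>x. x \<in> F \<Longrightarrow> c * h x = s False g x"
    and braid: "\<And>f. s True (s False (s True f)) = s False (s True (s False f))"
    and eig: "\<And>\<mu> v. \<mu> \<noteq> 0 \<Longrightarrow> (\<And>x. x \<notin> F \<Longrightarrow> v x = 0) \<Longrightarrow> v \<noteq> (\<lambda>_. 0) \<Longrightarrow>
      s True v = fun_scale \<mu> v \<Longrightarrow> root_of_unity_times_power q \<mu>"
  shows "root_of_unity_times_power q c"
proof (rule alternating_eigenvalue[where s = s and F = F and R = R and c = c and g = g and h = h and ?x0.0 = x0 and q = q,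
      OF F q s c g gh])
  define D where "D f = s True (s False (s True f))" for f
  have T: "s True (D f) = D (s False f)" and F: "s False (D f) = D (s True f)" for f
    unfolding D_def by (simp_all only: braid)
  \<comment> \<open>Of the six factors, the first three form \<open>D\<close> and the last three
    form the other side of the braid relation.\<close>
  have cube: "(s True \<circ> s False) ((s True \<circ> s False) ((s True \<circ> s False) f)) = D (D f)" for f
    unfolding D_def comp_apply by (simp only: braid)
  show "s i ((s True \<circ> s False) ((s True \<circ> s False) ((s True \<circ> s False) f))) =
      (s True \<circ> s False) ((s True \<circ> s False) ((s True \<circ> s False) (s i f)))" for i f
    unfolding cube by (cases i) (simp_all add: T F)
next
  fix i \<mu> v
  assume \<mu>: "\<mu> \<noteq> 0" and v: "\<And>x. x \<notin> F \<Longrightarrow> v x = 0" "v \<noteq> (\<lambda>_. 0)"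
    and cube: "(s True \<circ> s False) ((s True \<circ> s False) ((s True \<circ> s False) v)) = fun_scale (c ^ 6) v"
    and ev: "s i v = fun_scale \<mu> v"
  show "root_of_unity_times_power q \<mu>"
  proof (cases i)
    case True
    show ?thesis by (rule eig[OF \<mu> v]) (use ev True in simp_all)
  next
    case False
    \<comment> \<open>The half twist conjugates \<open>s False\<close> into \<open>s True\<close>, and it is injective on this eigenspace.\<close>
    define u where "u = s True (s False (s True v))"
    show ?thesis
    proof (rule eig[OF \<mu>])
      show "u x = 0" if "x \<notin> F" for x using that by (simp add: u_def s rel_op_def)
      show "u \<noteq> (\<lambda>_. 0)"
      proof
        assume "u = (\<lambda>_. 0)"
        then have "s True (s False (s True u)) = (\<lambda>_. 0)"
          by (simp add: s rel_op_def fun_eq_iff)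
        moreover have "s True (s False (s True u)) = fun_scale (c ^ 6) v"
          using cube unfolding u_def by (simp add: braid)
        ultimately show False using v(2) c by (auto simp: fun_scale_def fun_eq_iff)
      qed
      have "s True u = s True (s False (s True (s False v)))" by (simp add: u_def braid)
      also have "\<dots> = fun_scale \<mu> u" using ev False by (simp add: u_def s rel_op_scale)
      finally show "s True u = fun_scale \<mu> u" .
    qed
  qed
qed

section \<open>Opposition in the building of a vector space\<close>

lemma finite_coord_space: "finite (coord_space n :: (nat \<Rightarrow> 'k::{field,finite}) set)"
proof -
  have "finite {f :: nat \<Rightarrow> 'k. \<forall>x. (x \<in> {..<n} \<longrightarrow> f x \<in> UNIV) \<and> (x \<notin> {..<n} \<longrightarrow> f x = 0)}"
    by (rule finite_set_of_finite_funs) auto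
  moreover have "coord_space n = {f :: nat \<Rightarrow> 'k. \<forall>x. (x \<in> {..<n} \<longrightarrow> f x \<in> UNIV) \<and> (x \<notin> {..<n} \<longrightarrow> f x = 0)}"
    by (auto simp: coord_space_def)
  ultimately show ?thesis by simp
qed

lemma finite_field_space_fscale:
  "finite_field_space (fscale :: 'k::{field,finite} \<Rightarrow> (nat \<Rightarrow> 'k) \<Rightarrow> nat \<Rightarrow> 'k)"
  by (simp add: finite_field_space_def vector_space_fscale)

context finite_field_space
begin

abbreviation proper :: "'v set \<Rightarrow> 'v set set" where
  "proper V \<equiv> proper_subspaces scale V"

lemma proper_iff: "W \<in> proper V \<longleftrightarrow> subspace W \<and> W \<subseteq> V \<and> W \<noteq> {0} \<and> W \<noteq> V"
  by (simp add: proper_subspaces_def)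

lemma finite_proper: "finite V \<Longrightarrow> finite (proper V)"
  by (rule finite_subset[of _ "Pow V"]) (auto simp: proper_iff)

lemma complements_proper:
  assumes "A \<in> proper U" "B \<in> complements U A"
  shows "B \<in> proper U"
proof -
  have A: "subspace A" "A \<noteq> {0}" "A \<noteq> U" "0 \<in> A" using assms(1) by (auto simp: proper_iff subspace_0)
  have B: "subspace B" "A \<inter> B = {0}" "A + B = U" using assms(2) by (auto simp: complements_def)
  have "B \<subseteq> U" "A \<subseteq> U" using complements_subset[OF A(1) assms(2)] by auto
  moreover have "A + {0} = A" by (auto simp: set_plus_def)
  ultimately show ?thesis using A B by (auto simp: proper_iff)
qed

text \<open>Extending \<open>f\<close> by 0 to \<open>{0}\<close> and \<open>U\<close> preserves the
  eigenvalue equation, because complements of proper subspaces are proper and, by symmetry, other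
  subspaces have no proper complements.\<close>

lemma complement_operator_eigenvalue_proper:
  assumes U: "subspace U" "finite U" and \<mu>: "\<mu> \<noteq> 0" and A0: "A0 \<in> proper U" "f A0 \<noteq> 0"
    and ev: "\<And>A. A \<in> proper U \<Longrightarrow> \<mu> * f A = (\<Sum>B\<in>complements U A. f B)"
  shows "root_of_unity_times_power CARD('k) \<mu>"
proof (rule complement_operator_eigenvalue[OF U \<mu>])
  let ?f = "\<lambda>A. if A \<in> proper U then f A else 0"
  show "A0 \<in> subspaces_of U" "?f A0 \<noteq> 0" using A0 by (auto simp: proper_iff subspaces_of_def)
  fix A assume A: "A \<in> subspaces_of U"
  show "\<mu> * ?f A = (\<Sum>B\<in>complements U A. ?f B)"
  proof (cases "A \<in> proper U")
    case True
    then show ?thesis using ev[OF True] complements_proper[OF True] by (auto intro!: sum.cong)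
  next
    case False
    have "B \<notin> proper U" if B: "B \<in> complements U A" for B
    proof
      assume "B \<in> proper U"
      moreover have "A \<in> complements U B"
        using complements_commute[of A B U] A B by (auto simp: subspaces_of_def)
      ultimately show False using complements_proper False by blast
    qed
    then show ?thesis using False by (auto intro!: sum.neutral)
  qed
qed

section \<open>Direct sums of subspaces and of quotients\<close>

lemma direct_sum_iff_complement:
  assumes "subspace A" "subspace B" "subspace V"
  shows "Defs.direct_sum V A B \<longleftrightarrow> B \<in> complements V A"
proof
  assume ds: "Defs.direct_sum V A B"
  then have sub: "A \<subseteq> V" "B \<subseteq> V"
    and ex1: "\<And>v. v \<in> V \<Longrightarrow> \<exists>!p. p \<in> A \<times> B \<and> v = fst p + snd p"
    by (auto simp: Defs.direct_sum_def)
  have "V \<subseteq> A + B"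
  proof
    fix v assume "v \<in> V"
    then obtain p where "p \<in> A \<times> B" "v = fst p + snd p" using ex1 by blast
    then show "v \<in> A + B" by (metis mem_Times_iff set_plus_intro)
  qed
  moreover have "x = 0" if "x \<in> A" "x \<in> B" for x
  proof -
    \<comment> \<open>A common vector \<open>x\<close> decomposes both as \<open>x + 0\<close> and
      as \<open>0 + x\<close>.\<close>
    have "(x, 0) = (0, x)"
      using ex1[of x] that sub assms subspace_0
      by (metis (no_types, lifting) add.left_neutral add.right_neutral fst_conv mem_Sigma_iff snd_conv subsetD)
    then show ?thesis by simp
  qed
  ultimately show "B \<in> complements V A"
    using sum_subspaces_subset[OF assms(3) sub] assms subspace_0 by (auto simp: complements_def)
next
  assume B: "B \<in> complements V A"
  have sub: "A \<subseteq> V" "B \<subseteq> V" using complements_subset[OF assms(1) B] by auto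
  have "\<exists>!p. p \<in> A \<times> B \<and> v = fst p + snd p" if "v \<in> V" for v
  proof -
    have "v \<in> A + B" using that B by (simp add: complements_def)
    then obtain a b where ab: "a \<in> A" "b \<in> B" "v = a + b" by (auto simp: set_plus_def)
    have "a' = a \<and> b' = b" if "a' \<in> A" "b' \<in> B" "v = a' + b'" for a' b'
    proof -
      have d: "a' - a = b - b'" using that ab by (simp add: algebra_simps)
      then have "a' - a \<in> A \<inter> B" using that ab assms by (metis IntI subspace_diff)
      then have "a' - a = 0" using B unfolding complements_def by blast
      then show ?thesis using d by simp
    qed
    then show ?thesis using ab by (intro ex1I[of _ "(a, b)"]) auto
  qed
  then show "Defs.direct_sum V A B" using sub by (simp add: Defs.direct_sum_def)
qed

lemma coset_eq_iff: "subspace W \<Longrightarrow> u +o W = u' +o W \<longleftrightarrow> u - u' \<in> W"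
proof
  assume W: "subspace W" and "u +o W = u' +o W"
  then have "u \<in> u' +o W" using subspace_0[OF W] by (metis add.right_neutral set_plus_intro2)
  then show "u - u' \<in> W" by (auto simp: elt_set_plus_def)
next
  assume W: "subspace W" and d: "u - u' \<in> W"
  show "u +o W = u' +o W"
  proof (intro equalityI subsetI)
    fix x assume "x \<in> u +o W"
    then obtain w where "w \<in> W" "x = u' + ((u - u') + w)" by (auto simp: elt_set_plus_def)
    then show "x \<in> u' +o W" using d subspace_add[OF W] by (blast intro: set_plus_intro2)
  next
    fix x assume "x \<in> u' +o W"
    then obtain w where "w \<in> W" "x = u + (w - (u - u'))" by (auto simp: elt_set_plus_def)
    then show "x \<in> u +o W" using d subspace_diff[OF W] by (blast intro: set_plus_intro2)
  qed
qed

lemma coset_add: "subspace W \<Longrightarrow> (a +o W) + (b +o W) = (a + b) +o W"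
proof -
  assume W: "subspace W"
  have "W + W = W" using W subspace_add subset_sum_left[OF W, of W] by (auto simp: set_plus_def)
  then show ?thesis by (simp add: set_plus_rearrange)
qed

text \<open>The coset of \<open>x \<in> A \<inter> B\<close> has two decompositions, with the zero
  coset on either side, so uniqueness forces \<open>x \<in> W\<close>. Conversely, representatives
  of two decompositions of a coset differ by elements of \<open>A \<inter> B = W\<close>.\<close>

lemma direct_sum_quotient_iff:
  assumes W: "subspace W" "W \<subseteq> A" "W \<subseteq> B" and A: "subspace A" "A \<subseteq> V" and B: "subspace B" "B \<subseteq> V"
    and V: "subspace V"
  shows "Defs.direct_sum (quotient_space V W) (quotient_space A W) (quotient_space B W) \<longleftrightarrow>
    A \<inter> B = W \<and> A + B = V"
proof
  assume "Defs.direct_sum (quotient_space V W) (quotient_space A W) (quotient_space B W)"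
  then have ex1: "\<exists>!p. p \<in> quotient_space A W \<times> quotient_space B W \<and> v +o W = fst p + snd p"
    if "v \<in> V" for v
    using that by (auto simp: Defs.direct_sum_def quotient_space_def)
  have "V \<subseteq> A + B"
  proof
    fix v assume "v \<in> V"
    from ex1[OF this] obtain p where
      p: "p \<in> quotient_space A W \<times> quotient_space B W" "v +o W = fst p + snd p" by blast
    then obtain a b where "a \<in> A" "fst p = a +o W" "b \<in> B" "snd p = b +o W"
      by (auto simp: quotient_space_def mem_Times_iff)
    with p have ab: "a \<in> A" "b \<in> B" "v +o W = (a +o W) + (b +o W)" by simp_all
    then have "v - (a + b) \<in> W" by (simp add: coset_add W coset_eq_iff)
    then have "a + (v - (a + b)) \<in> A" using W ab A subspace_add by blast
    then have "a + (v - (a + b)) + b \<in> A + B" using ab by (intro set_plus_intro)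
    then show "v \<in> A + B" by (simp add: algebra_simps)
  qed
  moreover have "x \<in> W" if x: "x \<in> A" "x \<in> B" for x
  proof -
    let ?p = "(x +o W, 0 +o W)" and ?p' = "(0 +o W, x +o W)"
    have "?p \<in> quotient_space A W \<times> quotient_space B W" "?p' \<in> quotient_space A W \<times> quotient_space B W"
      using x subspace_0[OF A(1)] subspace_0[OF B(1)] unfolding quotient_space_def by blast+
    moreover have "x +o W = fst ?p + snd ?p" "x +o W = fst ?p' + snd ?p'"
      using W by (simp_all add: coset_add del: set_zero_plus)
    moreover have "x \<in> V" using x A by blast
    ultimately have "?p = ?p'" using ex1[of x] by blast
    then show "x \<in> W" using coset_eq_iff[OF W(1), of x 0] by simp
  qed
  ultimately show "A \<inter> B = W \<and> A + B = V"
    using sum_subspaces_subset[OF V A(2) B(2)] W by blast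
next
  assume AB: "A \<inter> B = W \<and> A + B = V"
  have "\<exists>!p. p \<in> quotient_space A W \<times> quotient_space B W \<and> y = fst p + snd p"
    if y: "y \<in> quotient_space V W" for y
  proof -
    obtain v where v: "v \<in> V" "y = v +o W" using y by (auto simp: quotient_space_def)
    obtain a b where ab: "a \<in> A" "b \<in> B" "v = a + b" using v AB by (auto simp: set_plus_def)
    have "a' +o W = a +o W \<and> b' +o W = b +o W"
      if "a' \<in> A" "b' \<in> B" "v +o W = (a' +o W) + (b' +o W)" for a' b'
    proof -
      have w: "v - (a' + b') \<in> W" using that W by (simp add: coset_add coset_eq_iff)
      have "a' - a = (b - b') - (v - (a' + b'))" using ab by (simp add: algebra_simps)
      also have "\<dots> \<in> B"
        by (rule subspace_diff[OF B(1) subspace_diff[OF B(1) ab(2) that(2)]]) (use w W in blast)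
      finally have a: "a' - a \<in> W" using AB that ab subspace_diff[OF A(1)] by blast
      have "b' - b = (a - a') - (v - (a' + b'))" using ab by (simp add: algebra_simps)
      also have "\<dots> \<in> A"
        by (rule subspace_diff[OF A(1) subspace_diff[OF A(1) ab(1) that(1)]]) (use w W in blast)
      finally have "b' - b \<in> W" using AB that ab subspace_diff[OF B(1)] by blast
      then show ?thesis using a W by (simp add: coset_eq_iff)
    qed
    then have uniq: "p = (a +o W, b +o W)"
      if "p \<in> quotient_space A W \<times> quotient_space B W" "y = fst p + snd p" for p
      using that unfolding v(2) by (cases p) (auto simp: quotient_space_def)
    have "(a +o W, b +o W) \<in> quotient_space A W \<times> quotient_space B W"
      using ab by (simp add: quotient_space_def)
    moreover have "y = fst (a +o W, b +o W) + snd (a +o W, b +o W)"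
      using v ab W by (simp add: coset_add)
    ultimately show ?thesis by (intro ex1I[of _ "(a +o W, b +o W)"] conjI uniq) (simp_all only:)
  qed
  then show "Defs.direct_sum (quotient_space V W) (quotient_space A W) (quotient_space B W)"
    using A B by (auto simp: Defs.direct_sum_def quotient_space_def)
qed

lemma oriented_edges_building:
  "(A, B) \<in> oriented_edges (building scale V) \<longleftrightarrow>
    A \<in> proper V \<and> B \<in> proper V \<and> (A \<subset> B \<or> B \<subset> A)"
  by (auto simp: oriented_edges_def building_def chain_subset_def)

lemma link_vertex_iff: "{y} \<in> link K x \<longleftrightarrow> (x, y) \<in> oriented_edges K"
  by (auto simp: link_def oriented_edges_def)

text \<open>The relator separates the two summands of the link, so a space below \<open>W\<close> is
  never opposite to one above it. In the first alternative \<open>B \<subset> W\<close> follows,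
  since complements of proper subspaces are proper.\<close>

lemma link_opp_iff:
  assumes "subspace V"
  shows "link_opp scale V W A B \<longleftrightarrow> W \<in> proper V \<and> A \<in> proper V \<and> B \<in> proper V \<and>
    (A \<subset> W \<and> B \<in> complements W A \<or> W \<subset> A \<and> W \<subset> B \<and> A \<inter> B = W \<and> A + B = V)"
proof (cases "(W, A) \<in> oriented_edges (building scale V) \<and> (W, B) \<in> oriented_edges (building scale V)")
  case True
  then have P: "W \<in> proper V" "A \<in> proper V" "B \<in> proper V" and
    ord: "W \<subset> A \<or> A \<subset> W" "W \<subset> B \<or> B \<subset> W" by (auto simp: oriented_edges_building)
  then have sub: "subspace W" "subspace A" "subspace B" "A \<subseteq> V" "B \<subseteq> V"
    by (auto simp: proper_iff)
  have noncomp: "\<not> W \<subset> B" if "B \<in> complements W A"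
    using complements_subset[OF sub(2) that] by blast
  show ?thesis
    using True P ord direct_sum_iff_complement[OF sub(2,3,1)] noncomp
      direct_sum_quotient_iff[OF sub(1) _ _ sub(2,4,3,5) assms]
    by (auto simp: link_opp_def link_vertex_iff link_vertex_def)
next
  case False
  have "B \<subset> W" if "W \<in> proper V" "A \<in> proper V" "B \<in> complements W A" "A \<subset> W"
  proof -
    have "A \<in> proper W" using that by (auto simp: proper_iff)
    from complements_proper[OF this that(3)] show ?thesis by (auto simp: proper_iff)
  qed
  then show ?thesis using False
    by (auto simp: link_opp_def link_vertex_iff oriented_edges_building)
qed

section \<open>Eigenfunctions on the edges of a single building\<close>

definition flags :: "'v set \<Rightarrow> ('v set \<times> 'v set) set" where
  "flags V = {(A, W). A \<in> proper V \<and> W \<in> proper V \<and> A \<subset> W}"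

text \<open>In the upper step, \<open>W \<inter> W' = A\<close> and \<open>W + W' = V\<close> say
  that \<open>W / A\<close> and \<open>W' / A\<close> are complements in
  \<open>V / A\<close>.\<close>

definition flag_step :: "'v set \<Rightarrow> bool \<Rightarrow> 'v set \<times> 'v set \<Rightarrow> 'v set \<times> 'v set \<Rightarrow> bool" where
  "flag_step V lower = (\<lambda>(A, W) (A', W').
     if lower then W = W' \<and> A' \<in> complements W A else A = A' \<and> W \<inter> W' = A \<and> W + W' = V)"

lemma flag_step_simps:
  "flag_step V True (A, W) (A', W') \<longleftrightarrow> W = W' \<and> A' \<in> complements W A"
  "flag_step V False (A, W) (A', W') \<longleftrightarrow> A = A' \<and> W \<inter> W' = A \<and> W + W' = V"
  by (auto simp: flag_step_def)

lemma finite_flags: "finite V \<Longrightarrow> finite (flags V)"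
  by (rule finite_subset[of _ "proper V \<times> proper V"]) (auto simp: flags_def finite_proper)

lemma flagsD:
  assumes "(A, W) \<in> flags V"
  shows "subspace A" "subspace W" "A \<subset> W" "W \<subseteq> V" "A \<noteq> {0}" "W \<noteq> V" "0 \<in> A"
  using assms subspace_0 by (auto simp: flags_def proper_iff)

section \<open>Opposite flags and the braid relation\<close>

lemma sum_self:
  assumes "subspace A" "B \<subseteq> A" "0 \<in> B"
  shows "A + B = A"
proof
  show "A + B \<subseteq> A" by (rule sum_subspaces_subset[OF assms(1) subset_refl assms(2)])
  have "x + 0 \<in> A + B" if "x \<in> A" for x using that assms(3) by (rule set_plus_intro)
  then show "A \<subseteq> A + B" by auto
qed

lemma subspace_sum_sets:
  assumes "subspace A" "subspace B"
  shows "subspace (A + B)"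
proof -
  have "A + B = {x + y |x y. x \<in> A \<and> y \<in> B}" by (auto simp: set_plus_def)
  then show ?thesis using subspace_sums[OF assms] by simp
qed

text \<open>Dedekind's modular law, which computes the intermediate spaces in the braid
  relation.\<close>

lemma modular: "subspace A \<Longrightarrow> subspace B \<Longrightarrow> subspace C \<Longrightarrow> A \<subseteq> C \<Longrightarrow> (A + B) \<inter> C = A + (B \<inter> C)"
proof (intro equalityI subsetI)
  fix x assume s: "subspace A" "subspace B" "subspace C" "A \<subseteq> C" and x: "x \<in> (A + B) \<inter> C"
  then obtain a b where ab: "a \<in> A" "b \<in> B" "x = a + b" by (auto simp: set_plus_def)
  then have "b = x - a" by simp
  also have "\<dots> \<in> C" using s x ab by (intro subspace_diff) auto
  finally show "x \<in> A + (B \<inter> C)" using ab by (auto simp: set_plus_def)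
next
  fix x assume s: "subspace A" "subspace B" "subspace C" "A \<subseteq> C" and "x \<in> A + (B \<inter> C)"
  then show "x \<in> (A + B) \<inter> C" by (auto simp: set_plus_def intro: subspace_add)
qed

text \<open>Opposition of the flags \<open>A < W\<close> and \<open>D < C\<close>. Both sides of the
  braid relation will be the operator of this relation.\<close>

definition flag_opposite :: "'v set \<Rightarrow> 'v set \<times> 'v set \<Rightarrow> 'v set \<times> 'v set \<Rightarrow> bool" where
  "flag_opposite V = (\<lambda>(A, W) (D, C). A \<inter> C = {0} \<and> A + C = V \<and> D \<inter> W = {0} \<and> D + W = V)"

text \<open>The steps must be \<open>(A, W)\<close>, \<open>(B, W)\<close>, \<open>(B, C)\<close>,
  \<open>(D, C)\<close>, and the upper step forces \<open>B = W \<inter> C\<close>. The existence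
  statement thus becomes a list of conditions on this \<open>B\<close>, which the modular law
  derives from opposition.\<close>

lemma flag_steps_lower:
  assumes V: "subspace V" and x: "(A, W) \<in> flags V" and z: "(D, C) \<in> flags V"
  shows "(\<exists>y\<in>flags V. flag_step V True (A, W) y \<and>
      (\<exists>y'\<in>flags V. flag_step V False y y' \<and> flag_step V True y' (D, C))) \<longleftrightarrow>
    flag_opposite V (A, W) (D, C)"
proof -
  note A = flagsD[OF x] and D = flagsD[OF z]
  define B where "B = W \<inter> C"
  have sB: "subspace B" unfolding B_def by (rule subspace_inter[OF A(2) D(2)])
  have eq: "(\<exists>y\<in>flags V. flag_step V True (A, W) y \<and>
      (\<exists>y'\<in>flags V. flag_step V False y y' \<and> flag_step V True y' (D, C))) \<longleftrightarrow>
    (B, W) \<in> flags V \<and> (B, C) \<in> flags V \<and> A \<inter> B = {0} \<and> A + B = W \<and> W + C = V \<and>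
      B \<inter> D = {0} \<and> B + D = C" (is "?l \<longleftrightarrow> ?r")
  proof
    assume ?l
    then show ?r by (auto simp: flag_step_simps complements_def B_def)
  next
    assume r: ?r
    then have "flag_step V True (A, W) (B, W)" "flag_step V False (B, W) (B, C)"
      "flag_step V True (B, C) (D, C)"
      using sB D(1) by (auto simp: flag_step_simps complements_def B_def)
    then show ?l using r by blast
  qed
  have fwd: "flag_opposite V (A, W) (D, C)"
    if "A \<inter> B = {0}" "A + B = W" "W + C = V" "B \<inter> D = {0}" "B + D = C"
  proof -
    have "A \<inter> C = {0}" "D \<inter> W = {0}" using that A(3) D(3) unfolding B_def by blast+
    \<comment> \<open>\<open>B\<close> is absorbed by \<open>C\<close>, so
      \<open>A + C = A + B + C = W + C = V\<close>; the sum \<open>D + W\<close> is treated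
      alike.\<close>
    moreover have "C = B + C" using sum_self[of C B] D(2) subspace_0[OF sB] by (simp add: B_def add.commute)
    then have "A + C = A + (B + C)" by simp
    then have "A + C = V" using that by (simp add: add.assoc[symmetric])
    moreover have "W = B + W" using sum_self[of W B] A(2) subspace_0[OF sB] by (simp add: B_def add.commute)
    then have "D + W = D + (B + W)" by simp
    then have "D + W = V" using that by (simp add: add.assoc[symmetric] add.commute)
    ultimately show ?thesis by (simp add: flag_opposite_def)
  qed
  have bwd: "(B, W) \<in> flags V \<and> (B, C) \<in> flags V \<and> A \<inter> B = {0} \<and> A + B = W \<and> W + C = V \<and>
      B \<inter> D = {0} \<and> B + D = C" if "flag_opposite V (A, W) (D, C)"
  proof -
    have o: "A \<inter> C = {0}" "A + C = V" "D \<inter> W = {0}" "D + W = V"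
      using that by (auto simp: flag_opposite_def)
    \<comment> \<open>As \<open>A \<subseteq> W\<close>, the modular law gives
      \<open>W = (A + C) \<inter> W = A + (C \<inter> W)\<close>.\<close>
    have 1: "A + B = W" using modular[OF A(1) D(2) A(2)] A(3,4) o(2) by (auto simp: B_def Int_commute)
    have 2: "D + B = C" using modular[OF D(1) A(2) D(2)] D(3,4) o(4) by (auto simp: B_def Int_commute)
    have 3: "A \<inter> B = {0}" "B \<inter> D = {0}" using o A(7) D(7) A(3) D(3) by (auto simp: B_def)
    have "V \<subseteq> W + C" using o(2) A(3) by (auto simp: set_plus_def)
    then have 4: "W + C = V" using sum_subspaces_subset[OF V A(4) D(4)] by blast
    have "B \<noteq> {0}" using 1 A(3) by (auto simp: set_plus_def)
    moreover have "B \<noteq> W" using 3 A(3,5) by blast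
    moreover have "B \<noteq> C" using 3 D(3,5) by blast
    moreover have "B \<subseteq> W" "B \<subseteq> C" by (auto simp: B_def)
    moreover have "B \<noteq> V" using \<open>B \<noteq> W\<close> \<open>B \<subseteq> W\<close> A(4) by blast
    ultimately have "B \<in> proper V" "B \<subset> W" "B \<subset> C"
      using sB A(4) unfolding proper_iff by blast+
    then have "(B, W) \<in> flags V" "(B, C) \<in> flags V" using x z unfolding flags_def by blast+
    moreover have "B + D = C" using 2 by (simp only: add.commute)
    ultimately show ?thesis using 1 3 4 by (intro conjI)
  qed
  show ?thesis unfolding eq by (rule iffI, elim conjE, rule fwd, assumption+, rule bwd, assumption)
qed

text \<open>Dual to \<open>flag_steps_lower\<close>: the steps are \<open>(A, W)\<close>,
  \<open>(A, B)\<close>, \<open>(D, B)\<close>, \<open>(D, C)\<close>, and the lower step forces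
  \<open>B = A + D\<close>.\<close>

lemma flag_steps_upper:
  assumes V: "subspace V" and x: "(A, W) \<in> flags V" and z: "(D, C) \<in> flags V"
  shows "(\<exists>y\<in>flags V. flag_step V False (A, W) y \<and>
      (\<exists>y'\<in>flags V. flag_step V True y y' \<and> flag_step V False y' (D, C))) \<longleftrightarrow>
    flag_opposite V (A, W) (D, C)"
proof -
  note A = flagsD[OF x] and D = flagsD[OF z]
  define B where "B = A + D"
  have sB: "subspace B" unfolding B_def by (rule subspace_sum_sets[OF A(1) D(1)])
  have sub: "A \<subseteq> B" "D \<subseteq> B" unfolding B_def using subset_sum_left[OF D(1)] subset_sum_right[OF A(1)] by auto
  have eq: "(\<exists>y\<in>flags V. flag_step V False (A, W) y \<and>
      (\<exists>y'\<in>flags V. flag_step V True y y' \<and> flag_step V False y' (D, C))) \<longleftrightarrow>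
    (A, B) \<in> flags V \<and> (D, B) \<in> flags V \<and> W \<inter> B = A \<and> W + B = V \<and> A \<inter> D = {0} \<and>
      B \<inter> C = D \<and> B + C = V" (is "?l \<longleftrightarrow> ?r")
  proof
    assume ?l
    then show ?r by (auto simp: flag_step_simps complements_def B_def)
  next
    assume r: ?r
    then have "flag_step V False (A, W) (A, B)" "flag_step V True (A, B) (D, B)"
      "flag_step V False (D, B) (D, C)"
      using D(1) by (auto simp: flag_step_simps complements_def B_def)
    then show ?l using r by blast
  qed
  have fwd: "flag_opposite V (A, W) (D, C)"
    if "W \<inter> B = A" "W + B = V" "A \<inter> D = {0}" "B \<inter> C = D" "B + C = V"
  proof -
    have "A \<inter> C = {0}" "D \<inter> W = {0}" using that sub by blast+
    moreover have "B + C = A + (D + C)" by (simp add: B_def add.assoc)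
    then have "A + C = V" using that sum_self[of C D] D by (simp add: add.commute)
    moreover have "W + B = D + (W + A)" by (simp add: B_def ac_simps)
    then have "D + W = V" using that sum_self[of W A] A by simp
    ultimately show ?thesis by (simp add: flag_opposite_def)
  qed
  have bwd: "(A, B) \<in> flags V \<and> (D, B) \<in> flags V \<and> W \<inter> B = A \<and> W + B = V \<and> A \<inter> D = {0} \<and>
      B \<inter> C = D \<and> B + C = V" if "flag_opposite V (A, W) (D, C)"
  proof -
    have o: "A \<inter> C = {0}" "A + C = V" "D \<inter> W = {0}" "D + W = V"
      using that by (auto simp: flag_opposite_def)
    have zero: "X + {0} = X" for X :: "'v set" by (auto simp: set_plus_def)
    have 1: "W \<inter> B = A" using modular[OF A(1) D(1) A(2)] A(3) o(3) by (auto simp: B_def Int_commute zero)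
    have 2: "B \<inter> C = D" using modular[OF D(1) A(1) D(2)] D(3) o(1) by (auto simp: B_def add.commute zero)
    have 3: "A \<inter> D = {0}" using o A(3,7) D(3,7) by blast
    have AV: "A \<subseteq> V" "D \<subseteq> V" using A(3,4) D(3,4) by blast+
    have BV: "B \<subseteq> V" unfolding B_def by (rule sum_subspaces_subset[OF V AV])
    have "B + W \<subseteq> V" "B + C \<subseteq> V"
      using sum_subspaces_subset[OF V BV A(4)] sum_subspaces_subset[OF V BV D(4)] .
    moreover have "V \<subseteq> B + W" using set_plus_mono2[OF sub(2) subset_refl[of W]] unfolding o(4) .
    moreover have "V \<subseteq> B + C" using set_plus_mono2[OF sub(1) subset_refl[of C]] unfolding o(2) .
    ultimately have 4: "W + B = V" "B + C = V" by (simp_all add: add.commute subset_antisym)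
    have "B \<noteq> V" using 1 A(3,4) by blast
    moreover have "B \<noteq> A" using 3 sub(2) D(5,7) by blast
    moreover have "B \<noteq> D" using 3 sub(1) A(5,7) by blast
    moreover have "B \<noteq> {0}" using sub(1) A(5,7) by blast
    ultimately have "B \<in> proper V" "A \<subset> B" "D \<subset> B"
      using sB BV sub unfolding proper_iff by blast+
    then have "(A, B) \<in> flags V" "(D, B) \<in> flags V" using x z unfolding flags_def by blast+
    then show ?thesis using 1 2 3 4 by (intro conjI)
  qed
  show ?thesis unfolding eq by (rule iffI, elim conjE, rule fwd, assumption+, rule bwd, assumption)
qed

lemma rel_op_lower_step:
  assumes "(A, W) \<in> flags V"
  shows "rel_op (flags V) (flag_step V True) f (A, W) = (\<Sum>B\<in>complements W A. f (B, W))"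
proof -
  have W: "W \<in> proper V" and A: "A \<in> proper W"
    using assms by (auto simp: flags_def proper_iff)
  have "(B, W) \<in> flags V" if "B \<in> complements W A" for B
    using complements_proper[OF A that] W by (auto simp: flags_def proper_iff)
  then have "{y. y \<in> flags V \<and> flag_step V True (A, W) y} = (\<lambda>B. (B, W)) ` complements W A"
    by (auto simp: flag_step_simps)
  then show ?thesis using assms by (simp add: rel_op_def sum.reindex inj_on_def)
qed

lemma rel_op_upper_step:
  assumes "(A, W) \<in> flags V"
  shows "rel_op (flags V) (flag_step V False) f (A, W) =
    (\<Sum>C | (A, C) \<in> flags V \<and> W \<inter> C = A \<and> W + C = V. f (A, C))"
proof -
  have "{y. y \<in> flags V \<and> flag_step V False (A, W) y} =
      Pair A ` {C. (A, C) \<in> flags V \<and> W \<inter> C = A \<and> W + C = V}"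
    by (auto simp: flag_step_simps)
  then show ?thesis using assms by (simp add: rel_op_def sum.reindex inj_on_def)
qed

text \<open>The end flags determine all intermediate flags, as intersections or sums of their
  members. So \<open>rel_op_comp\<close> turns each triple product into the operator of a relation,
  and both relations are opposition of flags.\<close>

lemma flag_step_braid:
  assumes V: "subspace V" "finite V"
  defines "s \<equiv> \<lambda>i. rel_op (flags V) (flag_step V i)"
  shows "s True (s False (s True f)) = s False (s True (s False f))"
proof -
  let ?F = "flags V" and ?R = "flag_step V"
  note fin = finite_flags[OF V(2)]
  have T: "snd y = snd x" "fst y \<in> complements (snd x) (fst x)" if "?R True x y" for x y
    using that by (auto simp: flag_step_def case_prod_beta)
  have F: "fst y = fst x" "snd x \<inter> snd y = fst x" if "?R False x y" for x y
    using that by (auto simp: flag_step_def case_prod_beta)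
  have TF: "s True (s False f) = rel_op ?F (\<lambda>x z. \<exists>y\<in>?F. ?R True x y \<and> ?R False y z) f" for f
    unfolding s_def by (rule rel_op_comp[OF fin]) (metis T(1) F(1) prod_eqI)
  have FT: "s False (s True f) = rel_op ?F (\<lambda>x z. \<exists>y\<in>?F. ?R False x y \<and> ?R True y z) f" for f
    unfolding s_def by (rule rel_op_comp[OF fin]) (metis T(1) F(1) prod_eqI)
  have lower: "y = (snd x \<inter> snd z, snd x)" if "?R True x y" "?R False y y'" "?R True y' z" for x y y' z
    using T(1)[OF that(1)] F(2)[OF that(2)] T(1)[OF that(3)] by (intro prod_eqI) simp_all
  have upper: "y = (fst x, fst x + fst z)" if "?R False x y" "?R True y y'" "?R False y' z" for x y y' z
    using F(1)[OF that(1)] T(2)[OF that(2)] F(1)[OF that(3)] by (intro prod_eqI) (simp_all add: complements_def)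
  have "s True (s False (s True f)) =
      rel_op ?F (\<lambda>x z. \<exists>y\<in>?F. ?R True x y \<and> (\<exists>y'\<in>?F. ?R False y y' \<and> ?R True y' z)) f"
    unfolding FT unfolding s_def
  proof (rule rel_op_comp[OF fin])
    fix x y y' z
    assume 1: "?R True x y" "?R True x y'" and 2: "\<exists>u\<in>?F. ?R False y u \<and> ?R True u z"
      "\<exists>u\<in>?F. ?R False y' u \<and> ?R True u z"
    obtain u u' where u: "?R False y u" "?R True u z" "?R False y' u'" "?R True u' z" using 2 by blast
    show "y = y'" using lower[OF 1(1) u(1,2)] lower[OF 1(2) u(3,4)] by simp
  qed
  also have "\<dots> = rel_op ?F (flag_opposite V) f"
    by (rule rel_op_cong[THEN fun_cong]) (use flag_steps_lower[OF V(1)] in fast)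
  also have "\<dots> = rel_op ?F (\<lambda>x z. \<exists>y\<in>?F. ?R False x y \<and> (\<exists>y'\<in>?F. ?R True y y' \<and> ?R False y' z)) f"
    by (rule rel_op_cong[THEN fun_cong, symmetric]) (use flag_steps_upper[OF V(1)] in fast)
  also have "\<dots> = s False (s True (s False f))"
    unfolding TF unfolding s_def
  proof (rule rel_op_comp[OF fin, symmetric])
    fix x y y' z
    assume 1: "?R False x y" "?R False x y'" and 2: "\<exists>u\<in>?F. ?R True y u \<and> ?R False u z"
      "\<exists>u\<in>?F. ?R True y' u \<and> ?R False u z"
    obtain u u' where u: "?R True y u" "?R False u z" "?R True y' u'" "?R False u' z" using 2 by blast
    show "y = y'" using upper[OF 1(1) u(1,2)] upper[OF 1(2) u(3,4)] by simp
  qed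
  finally show ?thesis .
qed

text \<open>The eigenfunction splits into its values \<open>f\<close> on edges directed upwards and
  \<open>h\<close> on edges directed downwards, both indexed by flags. Continuing an upward edge
  past \<open>W\<close> gives a downward edge with a new lower space, and vice versa, so the halves
  are exchanged by \<open>s True\<close> and \<open>s False\<close>.\<close>

lemma building_eigenvalue:
  assumes V: "subspace V" "finite V" and c: "c \<noteq> 0"
    and ex: "\<exists>e\<in>oriented_edges (building scale V). f e \<noteq> 0"
    and ev: "\<And>x y. (x, y) \<in> oriented_edges (building scale V) \<Longrightarrow> c * f (x, y) =
      (\<Sum>z | (y, z) \<in> oriented_edges (building scale V) \<and> link_opp scale V y x z. f (y, z))"
  shows "root_of_unity_times_power CARD('k) c"
proof -
  define s where "s i = rel_op (flags V) (flag_step V i)" for i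
  define h where "h = (\<lambda>(A, W). f (W, A))"
  obtain A1 W1 where 1: "(A1, W1) \<in> oriented_edges (building scale V)" "f (A1, W1) \<noteq> 0"
    using ex by fast
  then consider "(A1, W1) \<in> flags V" | "(W1, A1) \<in> flags V"
    unfolding oriented_edges_building flags_def by blast
  then obtain A0 W0 where 0: "(A0, W0) \<in> flags V" "f (A0, W0) \<noteq> 0 \<or> h (A0, W0) \<noteq> 0"
    using 1(2) by cases (auto simp: h_def)
  show ?thesis
  proof (rule braid_eigenvalue[where s = s and F = "flags V" and R = "flag_step V" and c = c
        and g = f and h = h and ?x0.0 = "(A0, W0)",
        OF finite_flags[OF V(2)] _ s_def c 0])
    show "c * f x = s True h x" if x: "x \<in> flags V" for x
    proof -
      obtain A W where [simp]: "x = (A, W)" by fastforce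
      have AW: "A \<in> proper V" "W \<in> proper V" "A \<subset> W" using x by (auto simp: flags_def)
      then have "A \<in> proper W" by (auto simp: proper_iff)
      have "B \<in> proper V \<and> B \<subset> W" if "B \<in> complements W A" for B
        using complements_proper[OF \<open>A \<in> proper W\<close> that] AW(2) by (auto simp: proper_iff)
      then have "{z. (W, z) \<in> oriented_edges (building scale V) \<and> link_opp scale V W A z} = complements W A"
        using AW unfolding link_opp_iff[OF V(1)] oriented_edges_building by blast
      then show ?thesis using ev[of A W] AW x
        by (simp add: s_def rel_op_lower_step h_def oriented_edges_building)
    qed
    show "c * h x = s False f x" if x: "x \<in> flags V" for x
    proof -
      obtain A W where [simp]: "x = (A, W)" by fastforce
      have AW: "A \<in> proper V" "W \<in> proper V" "A \<subset> W" using x by (auto simp: flags_def)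
      then have "{z. (A, z) \<in> oriented_edges (building scale V) \<and> link_opp scale V A W z} =
          {C. (A, C) \<in> flags V \<and> W \<inter> C = A \<and> W + C = V}"
        unfolding link_opp_iff[OF V(1)] oriented_edges_building flags_def by blast
      then show ?thesis using ev[of W A] AW x
        by (simp add: s_def rel_op_upper_step h_def oriented_edges_building)
    qed
    show "s True (s False (s True v)) = s False (s True (s False v))" for v
      unfolding s_def by (rule flag_step_braid[OF V])
    fix \<mu> v
    assume \<mu>: "\<mu> \<noteq> 0" and v: "\<And>x. x \<notin> flags V \<Longrightarrow> v x = 0" "v \<noteq> (\<lambda>_. 0)"
      and sv: "s True v = fun_scale \<mu> v"
    obtain A W where AW: "v (A, W) \<noteq> 0" using v(2) by fast
    then have x: "(A, W) \<in> flags V" using v(1) by blast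
    then have W: "W \<in> proper V" "A \<in> proper W" by (auto simp: flags_def proper_iff)
    \<comment> \<open>On flags with a fixed upper space \<open>W\<close>, the lower step is the
      complement operator of \<open>W\<close>.\<close>
    show "root_of_unity_times_power CARD('k) \<mu>"
    proof (rule complement_operator_eigenvalue_proper[of W \<mu> A "\<lambda>A. v (A, W)"])
      show "subspace W" "finite W" using W(1) finite_subset[OF _ V(2)] by (auto simp: proper_iff)
      show "\<mu> * v (A', W) = (\<Sum>B\<in>complements W A'. v (B, W))" if "A' \<in> proper W" for A'
      proof -
        have "(A', W) \<in> flags V" using that W(1) by (auto simp: flags_def proper_iff)
        then show ?thesis using fun_cong[OF sv, of "(A', W)"]
          by (simp add: s_def rel_op_lower_step fun_scale_def)
      qed
    qed (use \<mu> AW W in auto)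
  qed simp
qed

section \<open>Eigenfunctions on the edges of a join\<close>

definition pair_step :: "'v set \<Rightarrow> 'v set \<Rightarrow> bool \<Rightarrow> 'v set \<times> 'v set \<Rightarrow> 'v set \<times> 'v set \<Rightarrow> bool" where
  "pair_step U U' first = (\<lambda>(A, B) (A', B').
     if first then B = B' \<and> A' \<in> complements U A else A = A' \<and> B' \<in> complements U' B)"

lemma rel_op_pair_step:
  assumes "A \<in> proper U" "B \<in> proper U'"
  shows "rel_op (proper U \<times> proper U') (pair_step U U' True) f (A, B) = (\<Sum>A'\<in>complements U A. f (A', B))"
    and "rel_op (proper U \<times> proper U') (pair_step U U' False) f (A, B) = (\<Sum>B'\<in>complements U' B. f (A, B'))"
proof -
  have "{y. y \<in> proper U \<times> proper U' \<and> pair_step U U' True (A, B) y} = (\<lambda>A'. (A', B)) ` complements U A"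
    "{y. y \<in> proper U \<times> proper U' \<and> pair_step U U' False (A, B) y} = Pair A ` complements U' B"
    using assms by (auto simp: pair_step_def dest: complements_proper[OF assms(1)] complements_proper[OF assms(2)])
  then show "rel_op (proper U \<times> proper U') (pair_step U U' True) f (A, B) = (\<Sum>A'\<in>complements U A. f (A', B))"
    and "rel_op (proper U \<times> proper U') (pair_step U U' False) f (A, B) = (\<Sum>B'\<in>complements U' B. f (A, B'))"
    using assms by (simp_all add: rel_op_def sum.reindex inj_on_def)
qed

lemma pair_step_commute:
  fixes U U' :: "'v set"
  defines "s \<equiv> \<lambda>i. rel_op (proper U \<times> proper U') (pair_step U U' i)"
  shows "s True (s False f) = s False (s True f)"
proof
  fix x :: "'v set \<times> 'v set"
  obtain A B where [simp]: "x = (A, B)" by fastforce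
  show "s True (s False f) x = s False (s True f) x"
  proof (cases "A \<in> proper U \<and> B \<in> proper U'")
    case True
    then have "s True (s False f) x = (\<Sum>A'\<in>complements U A. \<Sum>B'\<in>complements U' B. f (A', B'))"
      unfolding s_def
      by (simp add: rel_op_pair_step complements_proper[of A] cong: sum.cong)
    also have "\<dots> = (\<Sum>B'\<in>complements U' B. \<Sum>A'\<in>complements U A. f (A', B'))" by (rule sum.swap)
    also have "\<dots> = s False (s True f) x" unfolding s_def using True
      by (simp add: rel_op_pair_step complements_proper[of B] cong: sum.cong)
    finally show ?thesis .
  qed (auto simp: s_def rel_op_def)
qed

text \<open>\<open>g\<close> and \<open>h\<close> are the values of an eigenfunction on the two
  orientations of edges between the factors. With one coordinate fixed, each generator is the
  complement operator of the other factor.\<close>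

lemma mixed_edge_eigenvalue:
  assumes U: "subspace U" "finite U" and U': "subspace U'" "finite U'" and c: "c \<noteq> 0"
    and x0: "A0 \<in> proper U" "B0 \<in> proper U'" "g (A0, B0) \<noteq> 0 \<or> h (A0, B0) \<noteq> 0"
    and gh: "\<And>A B. A \<in> proper U \<Longrightarrow> B \<in> proper U' \<Longrightarrow> c * g (A, B) = (\<Sum>A'\<in>complements U A. h (A', B))"
      "\<And>A B. A \<in> proper U \<Longrightarrow> B \<in> proper U' \<Longrightarrow> c * h (A, B) = (\<Sum>B'\<in>complements U' B. g (A, B'))"
  shows "root_of_unity_times_power CARD('k) c"
proof -
  let ?F = "proper U \<times> proper U'"
  define s where "s i = rel_op ?F (pair_step U U' i)" for i
  have fin: "finite ?F" using finite_proper U(2) U'(2) by blast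
  have x0': "(A0, B0) \<in> ?F" using x0 by blast
  show ?thesis
  proof (rule commuting_eigenvalue[where s = s and F = ?F and R = "pair_step U U'" and c = c
        and g = g and h = h and ?x0.0 = "(A0, B0)", OF fin _ s_def c x0' x0(3)])
    show "c * g x = s True h x" "c * h x = s False g x" if "x \<in> ?F" for x
      using that gh by (auto simp: s_def rel_op_pair_step)
    show "s True (s False f) = s False (s True f)" for f
      unfolding s_def by (rule pair_step_commute)
    fix i \<mu> v
    assume \<mu>: "\<mu> \<noteq> 0" and v: "\<And>x. x \<notin> ?F \<Longrightarrow> v x = 0" "v \<noteq> (\<lambda>_. 0)"
      and sv: "s i v = fun_scale \<mu> v"
    obtain A B where AB: "v (A, B) \<noteq> 0" using v(2) by fast
    then have x: "A \<in> proper U" "B \<in> proper U'" using v(1) by blast+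
    show "root_of_unity_times_power CARD('k) \<mu>"
    proof (cases i)
      case True
      show ?thesis
      proof (rule complement_operator_eigenvalue_proper[OF U \<mu>, of A "\<lambda>A. v (A, B)"])
        show "\<mu> * v (A', B) = (\<Sum>C\<in>complements U A'. v (C, B))" if "A' \<in> proper U" for A'
          using fun_cong[OF sv, of "(A', B)"] True that x by (simp add: s_def rel_op_pair_step fun_scale_def)
      qed (use x AB in auto)
    next
      case False
      show ?thesis
      proof (rule complement_operator_eigenvalue_proper[OF U' \<mu>, of B "\<lambda>B. v (A, B)"])
        show "\<mu> * v (A, B') = (\<Sum>C\<in>complements U' B'. v (A, C))" if "B' \<in> proper U'" for B'
          using fun_cong[OF sv, of "(A, B')"] False that x by (simp add: s_def rel_op_pair_step fun_scale_def)
      qed (use x AB in auto)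
    qed
  qed simp
qed

section \<open>Edges and eigenfunctions of a join\<close>

lemma join_iff:
  "T \<in> Defs.join Ks \<longleftrightarrow> (\<forall>(i, x)\<in>T. i < length Ks) \<and> (\<forall>i<length Ks. {x. (i, x) \<in> T} \<in> Ks ! i)"
proof
  assume "T \<in> Defs.join Ks"
  then obtain S where S: "T = (\<Union>i<length Ks. Pair i ` S i)" "\<And>i. i < length Ks \<Longrightarrow> S i \<in> Ks ! i"
    unfolding Defs.join_def by blast
  \<comment> \<open>The slices of \<open>T\<close> are the only possible choice of
    \<open>S\<close>.\<close>
  then have "{x. (i, x) \<in> T} = S i" if "i < length Ks" for i using that by auto
  then show "(\<forall>(i, x)\<in>T. i < length Ks) \<and> (\<forall>i<length Ks. {x. (i, x) \<in> T} \<in> Ks ! i)"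
    using S by auto
next
  assume *: "(\<forall>(i, x)\<in>T. i < length Ks) \<and> (\<forall>i<length Ks. {x. (i, x) \<in> T} \<in> Ks ! i)"
  then have "T = (\<Union>i<length Ks. Pair i ` {x. (i, x) \<in> T})" by auto
  moreover have "\<forall>i<length Ks. {x. (i, x) \<in> T} \<in> Ks ! i" using * by (rule conjunct2)
  ultimately show "T \<in> Defs.join Ks" unfolding Defs.join_def mem_Collect_eq
    by (intro exI[of _ "\<lambda>i. {x. (i, x) \<in> T}"] conjI)
qed

lemma building_simps:
  "{} \<in> building scale V" "{A} \<in> building scale V \<longleftrightarrow> A \<in> proper V"
  by (auto simp: building_def chain_subset_def)

lemma oriented_edges_join_building:
  "((i, A), (j, B)) \<in> oriented_edges (join_building scale Vs) \<longleftrightarrow>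
    i < length Vs \<and> j < length Vs \<and>
    (if i = j then (A, B) \<in> oriented_edges (building scale (Vs ! i))
     else A \<in> proper (Vs ! i) \<and> B \<in> proper (Vs ! j))"
proof -
  have eq: "{x. (k, x) \<in> {(i, A), (j, B)}} =
      (if k = i then if k = j then {A, B} else {A} else if k = j then {B} else {})" for k
    by auto
  show ?thesis
    unfolding oriented_edges_def join_building_def mem_Collect_eq prod.case join_iff eq
    by (auto simp: building_simps)
qed

text \<open>Opposite vertices lie in the same factor, so a continued edge stays inside one factor or
  keeps alternating between the same two. It suffices to restrict \<open>f\<close> to the edges of
  the kind on which it does not vanish.\<close>

lemma join_building_eigenvalue:
  assumes Vs: "\<And>V. V \<in> set Vs \<Longrightarrow> subspace V" "\<And>V. V \<in> set Vs \<Longrightarrow> finite V" and c: "c \<noteq> 0"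
    and ex: "\<exists>e\<in>oriented_edges (join_building scale Vs). f e \<noteq> 0"
    and ev: "\<And>x y. (x, y) \<in> oriented_edges (join_building scale Vs) \<Longrightarrow> c * f (x, y) =
      (\<Sum>z | (y, z) \<in> oriented_edges (join_building scale Vs) \<and> join_link_opp scale Vs y x z. f (y, z))"
  shows "root_of_unity_times_power CARD('k) c"
proof -
  let ?E = "oriented_edges (join_building scale Vs)"
  obtain i A j B where e: "((i, A), (j, B)) \<in> ?E" "f ((i, A), (j, B)) \<noteq> 0" using ex by fast
  then have ij: "i < length Vs" "j < length Vs" by (auto simp: oriented_edges_join_building)
  then have Vi: "subspace (Vs ! i)" "finite (Vs ! i)" and Vj: "subspace (Vs ! j)" "finite (Vs ! j)"
    using Vs by auto
  have sym: "(x, y) \<in> ?E \<longleftrightarrow> (y, x) \<in> ?E" for x y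
    by (auto simp: oriented_edges_def insert_commute)
  show ?thesis
  proof (cases "i = j")
    case True
    let ?E' = "oriented_edges (building scale (Vs ! i))"
    have iff: "((i, X), (i, Y)) \<in> ?E \<longleftrightarrow> (X, Y) \<in> ?E'" for X Y
      using ij by (simp add: oriented_edges_join_building)
    show ?thesis
    proof (rule building_eigenvalue[OF Vi c, of "\<lambda>(X, Y). f ((i, X), (i, Y))"])
      show "\<exists>e\<in>?E'. (case e of (X, Y) \<Rightarrow> f ((i, X), (i, Y))) \<noteq> 0"
        using e True iff by (intro bexI[of _ "(A, B)"]) auto
      fix X Y assume XY: "(X, Y) \<in> ?E'"
      have "{z. ((i, Y), z) \<in> ?E \<and> join_link_opp scale Vs (i, Y) (i, X) z} =
          Pair i ` {Z. (Y, Z) \<in> ?E' \<and> link_opp scale (Vs ! i) Y X Z}"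
      proof (intro equalityI subsetI)
        fix z assume z: "z \<in> {z. ((i, Y), z) \<in> ?E \<and> join_link_opp scale Vs (i, Y) (i, X) z}"
        obtain Z where "z = (i, Z)" using z by (cases z) (auto simp: join_link_opp_def)
        then show "z \<in> Pair i ` {Z. (Y, Z) \<in> ?E' \<and> link_opp scale (Vs ! i) Y X Z}"
          using z by (auto simp: join_link_opp_def iff)
      next
        have "(Y, X) \<in> ?E'" using XY sym iff by blast
        moreover fix z assume "z \<in> Pair i ` {Z. (Y, Z) \<in> ?E' \<and> link_opp scale (Vs ! i) Y X Z}"
        ultimately show "z \<in> {z. ((i, Y), z) \<in> ?E \<and> join_link_opp scale Vs (i, Y) (i, X) z}"
          using iff by (auto simp: join_link_opp_def link_vertex_iff)
      qed
      then show "c * (case (X, Y) of (X, Y) \<Rightarrow> f ((i, X), (i, Y))) =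
          (\<Sum>Z | (Y, Z) \<in> ?E' \<and> link_opp scale (Vs ! i) Y X Z. case (Y, Z) of (X, Y) \<Rightarrow> f ((i, X), (i, Y)))"
        using ev[of "(i, X)" "(i, Y)"] XY iff by (simp add: sum.reindex inj_on_def)
    qed
  next
    case False
    \<comment> \<open>Continuing past \<open>(j, Y)\<close> returns to the factor \<open>i\<close>,
      with \<open>X\<close> replaced by a complement. The indices are general because both
      orientations are needed.\<close>
    have step: "c * f ((i, X), (j, Y)) = (\<Sum>X'\<in>complements (Vs ! i) X. f ((j, Y), (i, X')))"
      if ij: "i < length Vs" "j < length Vs" "i \<noteq> j" and X: "X \<in> proper (Vs ! i)" and Y: "Y \<in> proper (Vs ! j)"
      for i j X Y
    proof -
      have Vi: "subspace (Vs ! i)" using Vs ij by auto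
      have ds: "Defs.direct_sum (Vs ! i) X Z \<longleftrightarrow> Z \<in> complements (Vs ! i) X" if "Z \<in> proper (Vs ! i)" for Z
        using that X Vi by (intro direct_sum_iff_complement) (auto simp: proper_iff)
      have "{z. ((j, Y), z) \<in> ?E \<and> join_link_opp scale Vs (j, Y) (i, X) z} = Pair i ` complements (Vs ! i) X"
      proof (intro equalityI subsetI)
        fix z assume z: "z \<in> {z. ((j, Y), z) \<in> ?E \<and> join_link_opp scale Vs (j, Y) (i, X) z}"
        obtain Z where "z = (i, Z)" using z by (cases z) (auto simp: join_link_opp_def)
        then show "z \<in> Pair i ` complements (Vs ! i) X"
          using z ds ij by (auto simp: join_link_opp_def oriented_edges_join_building)
      next
        fix z assume "z \<in> Pair i ` complements (Vs ! i) X"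
        then obtain Z where Z: "z = (i, Z)" "Z \<in> complements (Vs ! i) X" by blast
        then have "Z \<in> proper (Vs ! i)" using complements_proper[OF X] by blast
        then show "z \<in> {z. ((j, Y), z) \<in> ?E \<and> join_link_opp scale Vs (j, Y) (i, X) z}"
          using Z ds ij X Y by (auto simp: join_link_opp_def oriented_edges_join_building link_vertex_iff)
      qed
      then show ?thesis using ev[of "(i, X)" "(j, Y)"] ij X Y
        by (simp add: sum.reindex inj_on_def oriented_edges_join_building)
    qed
    show ?thesis
    proof (rule mixed_edge_eigenvalue[OF Vi Vj c, of A B "\<lambda>(X, Y). f ((i, X), (j, Y))" "\<lambda>(X, Y). f ((j, Y), (i, X))"])
      show "A \<in> proper (Vs ! i)" "B \<in> proper (Vs ! j)"
        using e False by (auto simp: oriented_edges_join_building)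
      show "(case (A, B) of (X, Y) \<Rightarrow> f ((i, X), (j, Y))) \<noteq> 0 \<or>
          (case (A, B) of (X, Y) \<Rightarrow> f ((j, Y), (i, X))) \<noteq> 0" using e by simp
    qed (use step ij False in auto)
  qed
qed

section \<open>Finiteness of the edge sets and conclusion\<close>

lemma finite_oriented_edges_building: "finite V \<Longrightarrow> finite (oriented_edges (building scale V))"
  by (rule finite_subset[of _ "proper V \<times> proper V"])
    (auto simp: oriented_edges_building finite_proper)

lemma finite_oriented_edges_join_building:
  assumes "\<And>V. V \<in> set Vs \<Longrightarrow> finite V"
  shows "finite (oriented_edges (join_building scale Vs))"
proof -
  let ?X = "{..<length Vs} \<times> (\<Union>V\<in>set Vs. proper V)"
  have "oriented_edges (join_building scale Vs) \<subseteq> ?X \<times> ?X"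
  proof (intro subrelI)
    fix x y assume "(x, y) \<in> oriented_edges (join_building scale Vs)"
    moreover obtain i A j B where [simp]: "x = (i, A)" "y = (j, B)" by fastforce
    ultimately have "((i, A), (j, B)) \<in> oriented_edges (join_building scale Vs)" by simp
    then have "i < length Vs" "j < length Vs" "A \<in> proper (Vs ! i)" "B \<in> proper (Vs ! j)"
      by (auto simp: oriented_edges_join_building oriented_edges_building split: if_splits)
    then show "(x, y) \<in> ?X \<times> ?X" by (auto intro: bexI[of _ "Vs ! i"] bexI[of _ "Vs ! j"])
  qed
  moreover have "finite (?X \<times> ?X)" using assms finite_proper by auto
  ultimately show ?thesis by (rule finite_subset)
qed

end

theorem mainTheorem1:
  fixes q :: nat
  assumes "primepow q" and "CARD('k::{field,finite}) = q"
  shows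
    "(\<forall>n\<ge>2.
        let V = coord_space n :: (nat \<Rightarrow> 'k) set;
            K = building fscale V;
            opp = link_opp fscale V
        in (\<exists>es. eigenvalue_list K opp es) \<and>
           (\<forall>es. eigenvalue_list K opp es \<longrightarrow> (\<forall>e\<in>set es. root_of_unity_times_power q e))) \<and>
     (\<forall>ns :: nat list.
        let Vs = map coord_space ns :: (nat \<Rightarrow> 'k) set list;
            K = join_building fscale Vs;
            opp = join_link_opp fscale Vs
        in (\<exists>es. eigenvalue_list K opp es) \<and>
           (\<forall>es. eigenvalue_list K opp es \<longrightarrow> (\<forall>e\<in>set es. root_of_unity_times_power q e)))"
proof -
  interpret finite_field_space "fscale :: 'k \<Rightarrow> (nat \<Rightarrow> 'k) \<Rightarrow> nat \<Rightarrow> 'k"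
    by (rule finite_field_space_fscale)
  show ?thesis
    unfolding Let_def assms(2)[symmetric]
  proof (intro conjI[of "\<forall>n\<ge>2. _ n"] allI impI)
    fix n :: nat
    let ?V = "coord_space n :: (nat \<Rightarrow> 'k) set"
    show "(\<exists>es. eigenvalue_list (building fscale ?V) (link_opp fscale ?V) es) \<and>
      (\<forall>es. eigenvalue_list (building fscale ?V) (link_opp fscale ?V) es \<longrightarrow>
        (\<forall>e\<in>set es. root_of_unity_times_power CARD('k) e))"
      by (rule eigenvalue_list_of_eigenfunctions[OF finite_oriented_edges_building[OF finite_coord_space]],
          rule building_eigenvalue[OF subspace_coord_space finite_coord_space])
  next
    fix ns :: "nat list"
    let ?Vs = "map coord_space ns :: (nat \<Rightarrow> 'k) set list"
    have Vs: "V \<in> set ?Vs \<Longrightarrow> subspace V" "V \<in> set ?Vs \<Longrightarrow> finite V" for V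
      using subspace_coord_space finite_coord_space by auto
    show "(\<exists>es. eigenvalue_list (join_building fscale ?Vs) (join_link_opp fscale ?Vs) es) \<and>
      (\<forall>es. eigenvalue_list (join_building fscale ?Vs) (join_link_opp fscale ?Vs) es \<longrightarrow>
        (\<forall>e\<in>set es. root_of_unity_times_power CARD('k) e))"
      by (rule eigenvalue_list_of_eigenfunctions[OF finite_oriented_edges_join_building[OF Vs(2)]],
          assumption, rule join_building_eigenvalue[OF Vs])
  qed
qed

end
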